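(* Every connected nonabelian cyclic metric Lie group is not compact.
   Context: A metric Lie group $(G,g)$ is a real Lie group $G$ with a left-invariant Riemannian metric $g$; $\mathfrak{g}$ is its Lie algebra and $\langle\cdot,\cdot\rangle$ is the inner product on $\mathfrak{g}$ induced by $g$. $(G,g)$ is called cyclic if $\langle [X,Y],Z\rangle+\langle [Y,Z],X\rangle+\langle [Z,X],Y\rangle=0$ for all $X,Y,Z\in\mathfrak{g}$. *)

theory Defs
  imports "HOL-Analysis.Analysis" "HOL-Algebra.Group"
begin

section \<open>Smooth maps between Euclidean spaces\<close>

text \<open>Only meant for open \<open>S\<close>: all derivatives are taken with respect to full neighbourhoods.\<close>

primrec Ck_on :: "nat \<Rightarrow> ('a::euclidean_space \<Rightarrow> 'b::euclidean_space) \<Rightarrow> 'a set \<Rightarrow> bool" where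
  "Ck_on 0 f S \<longleftrightarrow> continuous_on S f"
| "Ck_on (Suc k) f S \<longleftrightarrow> (\<forall>x\<in>S. f differentiable (at x)) \<and>
      (\<forall>v. Ck_on k (\<lambda>x. frechet_derivative f (at x) v) S)"

definition smooth_on :: "'a set \<Rightarrow> ('a::euclidean_space \<Rightarrow> 'b::euclidean_space) \<Rightarrow> bool" where
  "smooth_on S f \<longleftrightarrow> (\<forall>k. Ck_on k f S)"


section \<open>Smooth manifolds\<close>

text \<open>A chart is a pair of its domain and its coordinate map. The values of the coordinate map
  outside the domain are irrelevant. A manifold is given by a topology (whose \<open>topspace\<close> is the
  underlying set) and an atlas, which need not be maximal.\<close>

type_synonym ('p, 'e) chart = "'p set \<times> ('p \<Rightarrow> 'e)"

definition chart_inv :: "('p, 'e) chart \<Rightarrow> 'e \<Rightarrow> 'p" where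
  "chart_inv c = inv_into (fst c) (snd c)"

definition is_chart :: "'p topology \<Rightarrow> ('p, 'e::euclidean_space) chart \<Rightarrow> bool" where
  "is_chart T c \<longleftrightarrow> openin T (fst c) \<and> open (snd c ` fst c) \<and>
     homeomorphic_map (subtopology T (fst c)) (top_of_set (snd c ` fst c)) (snd c)"

definition smooth_manifold :: "'p topology \<Rightarrow> ('p, 'e::euclidean_space) chart set \<Rightarrow> bool" where
  "smooth_manifold T A \<longleftrightarrow>
     Hausdorff_space T \<and> second_countable T \<and>
     (\<forall>c\<in>A. is_chart T c) \<and> (\<Union>c\<in>A. fst c) = topspace T \<and>
     (\<forall>c\<in>A. \<forall>d\<in>A. smooth_on (snd c ` (fst c \<inter> fst d)) (snd d \<circ> chart_inv c))"

definition smooth_map ::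
  "'p topology \<Rightarrow> ('p, 'e::euclidean_space) chart set \<Rightarrow>
   'q topology \<Rightarrow> ('q, 'f::euclidean_space) chart set \<Rightarrow> ('p \<Rightarrow> 'q) \<Rightarrow> bool" where
  "smooth_map T A T' A' f \<longleftrightarrow> continuous_map T T' f \<and>
     (\<forall>c\<in>A. \<forall>d\<in>A'. smooth_on (snd c ` {p \<in> fst c. f p \<in> fst d}) (snd d \<circ> f \<circ> chart_inv c))"

definition prod_atlas ::
  "('p, 'e) chart set \<Rightarrow> ('q, 'f) chart set \<Rightarrow> ('p \<times> 'q, 'e \<times> 'f) chart set" where
  "prod_atlas A B = {(fst c \<times> fst d, map_prod (snd c) (snd d)) | c d. c \<in> A \<and> d \<in> B}"


section \<open>Tangent vectors and vector fields\<close>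

text \<open>A tangent vector at \<open>p\<close> is the family of its coordinate vectors, one for each chart of the
  atlas around \<open>p\<close>, related by the differentials of the changes of coordinates. The entries for
  all other charts are set to \<open>0\<close>; in particular the tangent space at a point outside the
  manifold consists of the zero family only.\<close>

type_synonym ('p, 'e) tvec = "('p, 'e) chart \<Rightarrow> 'e"

definition tangent_space :: "('p, 'e::euclidean_space) chart set \<Rightarrow> 'p \<Rightarrow> ('p, 'e) tvec set" where
  "tangent_space A p =
     {v. (\<forall>c. \<not> (c \<in> A \<and> p \<in> fst c) \<longrightarrow> v c = 0) \<and>
         (\<forall>c\<in>A. \<forall>d\<in>A. p \<in> fst c \<and> p \<in> fst d \<longrightarrow>
            v d = frechet_derivative (snd d \<circ> chart_inv c) (at (snd c p)) (v c))}"

text \<open>The differential of a smooth map at \<open>p\<close>. By the chain rule it does not depend on the chart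
  chosen around \<open>p\<close>.\<close>

definition differential ::
  "('p, 'e::euclidean_space) chart set \<Rightarrow> ('q, 'f::euclidean_space) chart set \<Rightarrow>
   ('p \<Rightarrow> 'q) \<Rightarrow> 'p \<Rightarrow> ('p, 'e) tvec \<Rightarrow> ('q, 'f) tvec" where
  "differential A A' f p v =
     (let c = (SOME c. c \<in> A \<and> p \<in> fst c) in
      (\<lambda>d. if d \<in> A' \<and> f p \<in> fst d
           then frechet_derivative (snd d \<circ> f \<circ> chart_inv c) (at (snd c p)) (v c) else 0))"

type_synonym ('p, 'e) vfield = "'p \<Rightarrow> ('p, 'e) tvec"

definition coord_rep :: "('p, 'e) chart \<Rightarrow> ('p, 'e) vfield \<Rightarrow> 'e \<Rightarrow> 'e" where
  "coord_rep c X = (\<lambda>x. X (chart_inv c x) c)"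

definition smooth_vector_field :: "('p, 'e::euclidean_space) chart set \<Rightarrow> ('p, 'e) vfield \<Rightarrow> bool" where
  "smooth_vector_field A X \<longleftrightarrow>
     (\<forall>p. X p \<in> tangent_space A p) \<and> (\<forall>c\<in>A. smooth_on (snd c ` fst c) (coord_rep c X))"

text \<open>In coordinates, \<open>[X, Y]\<^sup>k = \<Sum>\<^sub>i X\<^sup>i \<partial>\<^sub>i Y\<^sup>k - Y\<^sup>i \<partial>\<^sub>i X\<^sup>k\<close>, which is the commutator of
  \<open>X\<close> and \<open>Y\<close> as derivations of smooth functions.\<close>

definition lie_bracket ::
  "('p, 'e::euclidean_space) chart set \<Rightarrow> ('p, 'e) vfield \<Rightarrow> ('p, 'e) vfield \<Rightarrow> ('p, 'e) vfield" where
  "lie_bracket A X Y =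
     (\<lambda>p c. if c \<in> A \<and> p \<in> fst c
            then frechet_derivative (coord_rep c Y) (at (snd c p)) (X p c)
               - frechet_derivative (coord_rep c X) (at (snd c p)) (Y p c)
            else 0)"


section \<open>Riemannian metrics\<close>

definition inner_product_on ::
  "('p, 'e::euclidean_space) tvec set \<Rightarrow> (('p, 'e) tvec \<Rightarrow> ('p, 'e) tvec \<Rightarrow> real) \<Rightarrow> bool" where
  "inner_product_on V ip \<longleftrightarrow>
     (\<forall>u\<in>V. \<forall>v\<in>V. ip u v = ip v u) \<and>
     (\<forall>u\<in>V. \<forall>v\<in>V. \<forall>w\<in>V. ip (\<lambda>c. u c + v c) w = ip u w + ip v w) \<and>
     (\<forall>r. \<forall>u\<in>V. \<forall>v\<in>V. ip (\<lambda>c. r *\<^sub>R u c) v = r * ip u v) \<and>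
     (\<forall>u\<in>V. u \<noteq> (\<lambda>c. 0) \<longrightarrow> ip u u > 0)"

text \<open>The tangent vector at \<open>p\<close> whose coordinate vector in the chart \<open>c\<close> is \<open>e\<close>.\<close>

definition coord_vector ::
  "('p, 'e::euclidean_space) chart set \<Rightarrow> ('p, 'e) chart \<Rightarrow> 'p \<Rightarrow> 'e \<Rightarrow> ('p, 'e) tvec" where
  "coord_vector A c p e =
     (\<lambda>d. if d \<in> A \<and> p \<in> fst d
          then frechet_derivative (snd d \<circ> chart_inv c) (at (snd c p)) e else 0)"

text \<open>The last condition says that the coefficients \<open>g\<^sub>i\<^sub>j\<close> are smooth in each chart.\<close>

definition riemannian_metric ::
  "'p topology \<Rightarrow> ('p, 'e::euclidean_space) chart set \<Rightarrow>
   ('p \<Rightarrow> ('p, 'e) tvec \<Rightarrow> ('p, 'e) tvec \<Rightarrow> real) \<Rightarrow> bool" where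
  "riemannian_metric T A g \<longleftrightarrow>
     (\<forall>p\<in>topspace T. inner_product_on (tangent_space A p) (g p)) \<and>
     (\<forall>c\<in>A. \<forall>i\<in>Basis. \<forall>j\<in>Basis. smooth_on (snd c ` fst c)
        (\<lambda>x. g (chart_inv c x) (coord_vector A c (chart_inv c x) i)
                               (coord_vector A c (chart_inv c x) j)))"


section \<open>Cyclic metric Lie groups\<close>

definition lie_group ::
  "('p, 'm) monoid_scheme \<Rightarrow> 'p topology \<Rightarrow> ('p, 'e::euclidean_space) chart set \<Rightarrow> bool" where
  "lie_group G T A \<longleftrightarrow>
     group G \<and> topspace T = carrier G \<and> smooth_manifold T A \<and>
     smooth_map (prod_topology T T) (prod_atlas A A) T A (\<lambda>(x, y). x \<otimes>\<^bsub>G\<^esub> y) \<and>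
     smooth_map T A T A (\<lambda>x. inv\<^bsub>G\<^esub> x)"

text \<open>The Lie algebra consists of the left-invariant vector fields, with \<^const>\<open>lie_bracket\<close>.\<close>

definition lie_algebra ::
  "('p, 'm) monoid_scheme \<Rightarrow> ('p, 'e::euclidean_space) chart set \<Rightarrow> ('p, 'e) vfield set" where
  "lie_algebra G A =
     {X. smooth_vector_field A X \<and>
         (\<forall>a\<in>carrier G. \<forall>p\<in>carrier G.
            X (a \<otimes>\<^bsub>G\<^esub> p) = differential A A (\<lambda>q. a \<otimes>\<^bsub>G\<^esub> q) p (X p))}"

definition left_invariant_metric ::
  "('p, 'm) monoid_scheme \<Rightarrow> ('p, 'e::euclidean_space) chart set \<Rightarrow>
   ('p \<Rightarrow> ('p, 'e) tvec \<Rightarrow> ('p, 'e) tvec \<Rightarrow> real) \<Rightarrow> bool" where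
  "left_invariant_metric G A g \<longleftrightarrow>
     (\<forall>a\<in>carrier G. \<forall>p\<in>carrier G. \<forall>v\<in>tangent_space A p. \<forall>w\<in>tangent_space A p.
        g (a \<otimes>\<^bsub>G\<^esub> p) (differential A A (\<lambda>q. a \<otimes>\<^bsub>G\<^esub> q) p v) (differential A A (\<lambda>q. a \<otimes>\<^bsub>G\<^esub> q) p w)
          = g p v w)"

definition metric_lie_group ::
  "('p, 'm) monoid_scheme \<Rightarrow> 'p topology \<Rightarrow> ('p, 'e::euclidean_space) chart set \<Rightarrow>
   ('p \<Rightarrow> ('p, 'e) tvec \<Rightarrow> ('p, 'e) tvec \<Rightarrow> real) \<Rightarrow> bool" where
  "metric_lie_group G T A g \<longleftrightarrow>
     lie_group G T A \<and> riemannian_metric T A g \<and> left_invariant_metric G A g"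

text \<open>For a left-invariant metric, \<open>g\<^sub>p(X\<^sub>p, Y\<^sub>p)\<close> is independent of \<open>p\<close> for \<open>X\<close>, \<open>Y\<close> in the
  Lie algebra.\<close>

definition lie_inner ::
  "('p, 'm) monoid_scheme \<Rightarrow> ('p \<Rightarrow> ('p, 'e) tvec \<Rightarrow> ('p, 'e) tvec \<Rightarrow> real) \<Rightarrow>
   ('p, 'e) vfield \<Rightarrow> ('p, 'e) vfield \<Rightarrow> real" where
  "lie_inner G g X Y = g \<one>\<^bsub>G\<^esub> (X \<one>\<^bsub>G\<^esub>) (Y \<one>\<^bsub>G\<^esub>)"

definition cyclic_metric_lie_group ::
  "('p, 'm) monoid_scheme \<Rightarrow> 'p topology \<Rightarrow> ('p, 'e::euclidean_space) chart set \<Rightarrow>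
   ('p \<Rightarrow> ('p, 'e) tvec \<Rightarrow> ('p, 'e) tvec \<Rightarrow> real) \<Rightarrow> bool" where
  "cyclic_metric_lie_group G T A g \<longleftrightarrow>
     metric_lie_group G T A g \<and>
     (\<forall>X\<in>lie_algebra G A. \<forall>Y\<in>lie_algebra G A. \<forall>Z\<in>lie_algebra G A.
        lie_inner G g (lie_bracket A X Y) Z + lie_inner G g (lie_bracket A Y Z) X
          + lie_inner G g (lie_bracket A Z X) Y = 0)"

end

theory Submission
  imports Defs
begin

text \<open>
  Suppose that \<open>G\<close> is compact and connected. For \<open>Y\<close> in the Lie algebra, the continuous function
  \<open>a \<mapsto> \<bar>Ad\<^sub>a Y\<bar>\<^sup>2\<close> has a maximum; since \<open>Ad\<^sub>a\<^sub>b = Ad\<^sub>a Ad\<^sub>b\<close>, the vector \<open>Y' = Ad\<^sub>a Y\<close> at which it is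
  attained satisfies \<open>\<bar>Ad\<^sub>s Y'\<bar> \<le> \<bar>Y'\<bar>\<close> for all \<open>s\<close>. Along a curve through the identity with
  velocity \<open>X\<close> the second order condition at the maximum reads
  \<open>\<bar>[X, Y']\<bar>\<^sup>2 + \<langle>[X, [X, Y']], Y'\<rangle> \<le> 0\<close>. Put \<open>L X = [X, Y']\<close>. Cyclicity applied to \<open>X\<close>,
  \<open>L X\<close>, \<open>Y'\<close> replaces the second term by \<open>\<bar>L X\<bar>\<^sup>2 - \<langle>L (L X), X\<rangle>\<close>, so that
  \<open>2 \<bar>L X\<bar>\<^sup>2 \<le> \<langle>L (L X), X\<rangle>\<close> for every \<open>X\<close>. As the right-hand side is at most
  \<open>\<parallel>L\<parallel>\<^sup>2 \<bar>X\<bar>\<^sup>2\<close>, this forces \<open>2 \<parallel>L\<parallel>\<^sup>2 \<le> \<parallel>L\<parallel>\<^sup>2\<close> and hence \<open>L = 0\<close>: the vector \<open>Y'\<close> is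
  central. These two steps are \<open>bracket_eq_0_at_orbit_max\<close> and \<open>linear_eq_0_of_square_bound\<close>.
  They replace the usual averaging of the metric over \<open>G\<close>, so no invariant measure is involved.

  A central \<open>Y'\<close> is fixed by all \<open>Ad\<^sub>s\<close>: the derivative of \<open>s \<mapsto> Ad\<^sub>s Y'\<close> vanishes, so the
  stabiliser of \<open>Y'\<close> is a subgroup that contains a neighbourhood of the identity, and in a connected
  group such a subgroup is everything. In particular \<open>Y = Y'\<close>, and \<open>Ad\<close> is trivial
  (\<open>Ad_trivial\<close>). Then the commutator map \<open>x \<mapsto> a x a\<inverse> x\<inverse>\<close> has derivative \<open>Ad\<^sub>a - id = 0\<close> at the
  identity, and at every other point as well because translations carry it to itself. So it is
  constant near the identity, the centraliser of \<open>a\<close> contains a neighbourhood of the identity,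
  and \<open>a\<close> is central in \<open>G\<close> (\<open>commute_of_Ad_trivial\<close>). Neither an exponential map nor a flow occurs.

  The calculation takes place in one chart \<open>c\<close> around the identity, which identifies the Lie algebra
  with the model space: \<open>left_field w\<close> is the left-invariant field whose value at the identity has
  the coordinate vector \<open>w\<close>. If \<open>F\<close> is the multiplication in this chart, the bracket
  of two such fields is the antisymmetrised mixed second derivative of \<open>F\<close>
  (\<open>lie_bracket_left_field\<close>), and this is also the derivative of \<open>Ad\<close> at the identity
  (\<open>Ad_has_derivative_one\<close>).
\<close>

section \<open>Smooth maps and second derivatives\<close>

lemma frechet_derivative_eqI:
  "(f has_derivative f') (at x) \<Longrightarrow> frechet_derivative f (at x) = f'"
  using frechet_derivative_at by metis

lemma Ck_on_cong:
  assumes "open S" "\<And>x. x \<in> S \<Longrightarrow> f x = g x" "Ck_on k f S"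
  shows "Ck_on k g S"
  using assms(2,3)
proof (induction k arbitrary: f g)
  case 0
  then show ?case by (metis Ck_on.simps(1) continuous_on_cong)
next
  case (Suc k)
  have der: "(g has_derivative frechet_derivative f (at x)) (at x)" if "x \<in> S" for x
    using Suc.prems that assms(1)
    by (metis Ck_on.simps(2) frechet_derivative_works has_derivative_transform_within_open)
  then have "\<forall>x\<in>S. g differentiable (at x)"
    unfolding differentiable_def by blast
  moreover have "Ck_on k (\<lambda>x. frechet_derivative g (at x) v) S" for v
  proof (rule Suc.IH)
    show "frechet_derivative f (at x) v = frechet_derivative g (at x) v" if "x \<in> S" for x
      using frechet_derivative_eqI[OF der[OF that]] by simp
    show "Ck_on k (\<lambda>x. frechet_derivative f (at x) v) S" using Suc.prems(2) by simp
  qed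
  ultimately show ?case by simp
qed

lemma smooth_on_cong:
  "open S \<Longrightarrow> (\<And>x. x \<in> S \<Longrightarrow> f x = g x) \<Longrightarrow> smooth_on S f \<Longrightarrow> smooth_on S g"
  unfolding smooth_on_def using Ck_on_cong by blast

lemma smooth_on_has_derivative:
  assumes "smooth_on S f" "x \<in> S"
  shows "(f has_derivative frechet_derivative f (at x)) (at x)"
  using assms unfolding smooth_on_def
  by (metis Ck_on.simps(2) frechet_derivative_works)

lemma smooth_on_directional_derivative:
  "smooth_on S f \<Longrightarrow> smooth_on S (\<lambda>x. frechet_derivative f (at x) v)"
  unfolding smooth_on_def by (metis Ck_on.simps(2))

lemma smooth_on_continuous_on: "smooth_on S f \<Longrightarrow> continuous_on S f"
  unfolding smooth_on_def by (metis Ck_on.simps(1))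

lemma smooth_on_linear_derivative:
  assumes "smooth_on S f" "x \<in> S"
  shows "linear (frechet_derivative f (at x))"
  using smooth_on_has_derivative[OF assms] has_derivative_linear by blast

lemma Ck_on_slice:
  fixes f :: "'a::euclidean_space \<times> 'b::euclidean_space \<Rightarrow> 'c::euclidean_space"
  assumes "open S" "Ck_on k f S"
  shows "Ck_on k (\<lambda>y. f (y, z)) {y. (y, z) \<in> S}"
  using assms(2)
proof (induction k arbitrary: f)
  case 0
  then show ?case
    by (auto intro!: continuous_on_compose2[of S f] continuous_intros)
next
  case (Suc k)
  have op: "open {y. (y, z) \<in> S}"
    using open_vimage[OF assms(1), of "\<lambda>y. (y, z)"] by (simp add: vimage_def continuous_on_Pair)
  have der: "((\<lambda>y. f (y, z)) has_derivative (\<lambda>v. frechet_derivative f (at (y, z)) (v, 0))) (at y)"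
    if "(y, z) \<in> S" for y
  proof (rule has_derivative_compose[of "\<lambda>y. (y, z)" "\<lambda>v. (v, 0)"])
    show "((\<lambda>y. (y, z)) has_derivative (\<lambda>v. (v, 0))) (at y)"
      by (intro has_derivative_Pair has_derivative_ident has_derivative_const)
    show "(f has_derivative frechet_derivative f (at (y, z))) (at (y, z))"
      using Suc.prems that frechet_derivative_works[THEN iffD1] by auto
  qed
  show ?case
  proof (simp, intro conjI allI impI)
    fix y assume "(y, z) \<in> S"
    then show "(\<lambda>y. f (y, z)) differentiable at y" using der by (auto simp: differentiable_def)
  next
    fix v
    show "Ck_on k (\<lambda>y. frechet_derivative (\<lambda>y. f (y, z)) (at y) v) {y. (y, z) \<in> S}"
    proof (rule Ck_on_cong[OF op])
      show "Ck_on k (\<lambda>y. frechet_derivative f (at (y, z)) (v, 0)) {y. (y, z) \<in> S}"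
        by (rule Suc.IH) (use Suc.prems in simp)
      show "frechet_derivative f (at (y, z)) (v, 0) = frechet_derivative (\<lambda>y. f (y, z)) (at y) v"
        if "y \<in> {y. (y, z) \<in> S}" for y
        using frechet_derivative_eqI[OF der] that by simp
    qed
  qed
qed

lemma smooth_on_slice:
  fixes f :: "'a::euclidean_space \<times> 'b::euclidean_space \<Rightarrow> 'c::euclidean_space"
  assumes "open S" "smooth_on S f"
  shows "smooth_on {y. (y, z) \<in> S} (\<lambda>y. f (y, z))"
  using assms unfolding smooth_on_def by (blast intro: Ck_on_slice)

text \<open>Applying the mean value theorem first in the direction \<open>u\<close> and then in the direction \<open>v\<close> gives
  a second derivative at a point of the small parallelogram. The left-hand side is symmetric in
  \<open>u\<close> and \<open>v\<close>, which makes this the source of the symmetry of second derivatives.\<close>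

lemma second_difference_eq:
  fixes g :: "'a::real_normed_vector \<Rightarrow> real"
  assumes h: "h > 0"
    and g: "\<And>s t. \<lbrakk>s \<in> {0..h}; t \<in> {0..h}\<rbrakk> \<Longrightarrow>
      (g has_derivative g' (p + s *\<^sub>R u + t *\<^sub>R v)) (at (p + s *\<^sub>R u + t *\<^sub>R v))"
    and g': "\<And>s t. \<lbrakk>s \<in> {0..h}; t \<in> {0..h}\<rbrakk> \<Longrightarrow>
      ((\<lambda>x. g' x u) has_derivative H (p + s *\<^sub>R u + t *\<^sub>R v)) (at (p + s *\<^sub>R u + t *\<^sub>R v))"
  shows "\<exists>s\<in>{0..h}. \<exists>t\<in>{0..h}. g (p + h *\<^sub>R u + h *\<^sub>R v) - g (p + h *\<^sub>R u) - g (p + h *\<^sub>R v) + g p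
           = h^2 * H (p + s *\<^sub>R u + t *\<^sub>R v) v"
proof -
  define \<phi> where "\<phi> s = g (p + s *\<^sub>R u + h *\<^sub>R v) - g (p + s *\<^sub>R u + 0 *\<^sub>R v)" for s
  have line_u: "((\<lambda>s. g (p + s *\<^sub>R u + t *\<^sub>R v)) has_derivative
      (\<lambda>d. g' (p + s *\<^sub>R u + t *\<^sub>R v) (d *\<^sub>R u))) (at s within W)"
    if "s \<in> {0..h}" "t \<in> {0..h}" for s t W
    by (rule has_derivative_compose[where f="\<lambda>s. p + s *\<^sub>R u + t *\<^sub>R v", OF _ g[OF that]]) (auto intro!: derivative_eq_intros)
  have line_v: "((\<lambda>t. g' (p + s *\<^sub>R u + t *\<^sub>R v) u) has_derivative
      (\<lambda>d. H (p + s *\<^sub>R u + t *\<^sub>R v) (d *\<^sub>R v))) (at t within W)"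
    if "s \<in> {0..h}" "t \<in> {0..h}" for s t W
    by (rule has_derivative_compose[where f="\<lambda>t. p + s *\<^sub>R u + t *\<^sub>R v", OF _ g'[OF that]]) (auto intro!: derivative_eq_intros)
  have "\<exists>s\<in>{0<..<h}. \<phi> h - \<phi> 0 =
      (\<lambda>d. g' (p + s *\<^sub>R u + h *\<^sub>R v) (d *\<^sub>R u) - g' (p + s *\<^sub>R u + 0 *\<^sub>R v) (d *\<^sub>R u)) (h - 0)"
    unfolding \<phi>_def using h
    by (intro mvt_simple has_derivative_diff line_u) auto
  then obtain s where s: "s \<in> {0<..<h}"
    and 1: "\<phi> h - \<phi> 0 = h * (g' (p + s *\<^sub>R u + h *\<^sub>R v) u - g' (p + s *\<^sub>R u + 0 *\<^sub>R v) u)"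
    using h linear_scale[OF has_derivative_linear[OF g]] by (auto simp: right_diff_distrib simp del: scaleR_zero_left)
  have "\<exists>t\<in>{0<..<h}. g' (p + s *\<^sub>R u + h *\<^sub>R v) u - g' (p + s *\<^sub>R u + 0 *\<^sub>R v) u =
      (\<lambda>d. H (p + s *\<^sub>R u + t *\<^sub>R v) (d *\<^sub>R v)) (h - 0)"
  proof (rule mvt_simple[where f="\<lambda>t. g' (p + s *\<^sub>R u + t *\<^sub>R v) u"
          and f'="\<lambda>t d. H (p + s *\<^sub>R u + t *\<^sub>R v) (d *\<^sub>R v)", OF h])
    fix t assume "0 \<le> t" "t \<le> h"
    with s show "((\<lambda>t. g' (p + s *\<^sub>R u + t *\<^sub>R v) u) has_derivative
        (\<lambda>d. H (p + s *\<^sub>R u + t *\<^sub>R v) (d *\<^sub>R v))) (at t within {0..h})"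
      by (intro line_v) auto
  qed
  then obtain t where t: "t \<in> {0<..<h}"
    and 2: "g' (p + s *\<^sub>R u + h *\<^sub>R v) u - g' (p + s *\<^sub>R u + 0 *\<^sub>R v) u = h * H (p + s *\<^sub>R u + t *\<^sub>R v) v"
    using s linear_scale[OF has_derivative_linear[OF g']] by (auto simp del: scaleR_zero_left)
  have "\<phi> h - \<phi> 0 = h^2 * H (p + s *\<^sub>R u + t *\<^sub>R v) v"
    using 1 2 by (simp add: power2_eq_square)
  then show ?thesis
    using s t by (intro bexI[of _ s] bexI[of _ t]) (auto simp: \<phi>_def)
qed

text \<open>Both orders of differentiation express the same second difference over \<open>h\<^sup>2\<close>, at points that
  tend to \<open>p\<close> with \<open>h\<close>; continuity of the second derivatives does the rest.\<close>

lemma second_derivative_symmetric: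
  fixes f :: "'a::euclidean_space \<Rightarrow> 'b::euclidean_space"
  assumes S: "open S" "p \<in> S" and f: "smooth_on S f"
  shows "frechet_derivative (\<lambda>x. frechet_derivative f (at x) u) (at p) v
       = frechet_derivative (\<lambda>x. frechet_derivative f (at x) v) (at p) u" (is "?H u v p = ?H v u p")
proof (rule euclidean_eqI)
  let ?D = "\<lambda>x. frechet_derivative f (at x)"
  let ?H = "\<lambda>u v x. frechet_derivative (\<lambda>x. ?D x u) (at x) v"
  fix i :: 'b assume i: "i \<in> Basis"
  obtain r where r: "r > 0" "ball p r \<subseteq> S" using S openE by blast
  have cont: "isCont (\<lambda>x. ?H u v x \<bullet> i) p" for u v
    using smooth_on_continuous_on[OF smooth_on_directional_derivative[OF smooth_on_directional_derivative[OF f]]]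
    by (auto intro!: continuous_intros simp: continuous_on_eq_continuous_at[OF S(1)] S(2))
  have "\<bar>?H u v p \<bullet> i - ?H v u p \<bullet> i\<bar> \<le> 0 + e" if e: "e > 0" for e
  proof -
    obtain d1 where d1: "d1 > 0" "\<And>x. dist x p < d1 \<Longrightarrow> \<bar>?H u v x \<bullet> i - ?H u v p \<bullet> i\<bar> < e / 2"
      using cont[of u v, unfolded continuous_at_eps_delta] e by (metis dist_real_def half_gt_zero)
    obtain d2 where d2: "d2 > 0" "\<And>x. dist x p < d2 \<Longrightarrow> \<bar>?H v u x \<bullet> i - ?H v u p \<bullet> i\<bar> < e / 2"
      using cont[of v u, unfolded continuous_at_eps_delta] e by (metis dist_real_def half_gt_zero)
    define d where "d = min r (min d1 d2)"
    (* small enough for the parallelogram spanned by h u and h v to stay within distance d of p *)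
    define h where "h = d / (2 * (norm u + norm v + 1))"
    have d: "d > 0" using r d1 d2 by (simp add: d_def)
    have h: "h > 0" using d by (simp add: h_def add_nonneg_pos)
    have near: "dist (p + s *\<^sub>R x + t *\<^sub>R y) p < d"
      if "s \<in> {0..h}" "t \<in> {0..h}" "x = u \<and> y = v \<or> x = v \<and> y = u" for s t x y
    proof -
      have "dist (p + s *\<^sub>R x + t *\<^sub>R y) p \<le> s * norm x + t * norm y"
        using that norm_triangle_ineq[of "s *\<^sub>R x" "t *\<^sub>R y"] by (simp add: dist_norm)
      also have "\<dots> \<le> h * norm x + h * norm y"
        using that by (intro add_mono mult_right_mono) auto
      also have "\<dots> = h * (norm u + norm v)" using that by (auto simp: algebra_simps)
      also have "\<dots> < d"
        using d unfolding h_def by (simp add: divide_simps add_nonneg_pos)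
      finally show ?thesis .
    qed
    have *: "\<exists>s\<in>{0..h}. \<exists>t\<in>{0..h}. f (p + h *\<^sub>R x + h *\<^sub>R y) \<bullet> i - f (p + h *\<^sub>R x) \<bullet> i - f (p + h *\<^sub>R y) \<bullet> i + f p \<bullet> i
           = h^2 * (\<lambda>z w. ?H x w z \<bullet> i) (p + s *\<^sub>R x + t *\<^sub>R y) y"
      if "x = u \<and> y = v \<or> x = v \<and> y = u" for x y
      using near[OF _ _ that] r d
      by (intro second_difference_eq[where g="\<lambda>x. f x \<bullet> i" and g'="\<lambda>x w. ?D x w \<bullet> i"] h has_derivative_inner_left
          smooth_on_has_derivative[OF f] smooth_on_has_derivative[OF smooth_on_directional_derivative[OF f]])
        (force simp: d_def dist_commute)+
    obtain s t where 1: "s \<in> {0..h}" "t \<in> {0..h}"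
      "f (p + h *\<^sub>R u + h *\<^sub>R v) \<bullet> i - f (p + h *\<^sub>R u) \<bullet> i - f (p + h *\<^sub>R v) \<bullet> i + f p \<bullet> i
        = h^2 * (?H u v (p + s *\<^sub>R u + t *\<^sub>R v) \<bullet> i)" using *[of u v] by auto
    obtain s' t' where 2: "s' \<in> {0..h}" "t' \<in> {0..h}"
      "f (p + h *\<^sub>R v + h *\<^sub>R u) \<bullet> i - f (p + h *\<^sub>R v) \<bullet> i - f (p + h *\<^sub>R u) \<bullet> i + f p \<bullet> i
        = h^2 * (?H v u (p + s' *\<^sub>R v + t' *\<^sub>R u) \<bullet> i)" using *[of v u] by auto
    have "f (p + h *\<^sub>R u + h *\<^sub>R v) \<bullet> i = f (p + h *\<^sub>R v + h *\<^sub>R u) \<bullet> i" by (simp add: algebra_simps)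
    then have "h^2 * (?H u v (p + s *\<^sub>R u + t *\<^sub>R v) \<bullet> i) = h^2 * (?H v u (p + s' *\<^sub>R v + t' *\<^sub>R u) \<bullet> i)"
      using 1(3) 2(3) by linarith
    then have "?H u v (p + s *\<^sub>R u + t *\<^sub>R v) \<bullet> i = ?H v u (p + s' *\<^sub>R v + t' *\<^sub>R u) \<bullet> i" using h by simp
    moreover have "\<bar>?H u v (p + s *\<^sub>R u + t *\<^sub>R v) \<bullet> i - ?H u v p \<bullet> i\<bar> < e / 2"
      using near[OF 1(1,2), of u v] by (intro d1) (auto simp: d_def)
    moreover have "\<bar>?H v u (p + s' *\<^sub>R v + t' *\<^sub>R u) \<bullet> i - ?H v u p \<bullet> i\<bar> < e / 2"
      using near[OF 2(1,2), of v u] by (intro d2) (auto simp: d_def)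
    ultimately show ?thesis by linarith
  qed
  then have "\<bar>?H u v p \<bullet> i - ?H v u p \<bullet> i\<bar> \<le> 0" by (rule field_le_epsilon)
  then show "?H u v p \<bullet> i = ?H v u p \<bullet> i" by simp
qed

text \<open>The product rule for a family of linear maps that is only known to be differentiable when applied
  to each fixed vector. Expanding \<open>a y\<close> in a basis reduces it to products of scalars and vectors,
  without a norm on the space of linear maps.\<close>

lemma has_derivative_linear_family_apply:
  fixes Q :: "'a::real_normed_vector \<Rightarrow> 'b::euclidean_space \<Rightarrow> 'c::real_normed_vector"
  assumes lin: "\<forall>\<^sub>F y in nhds x. linear (Q y)"
    and Q: "\<And>w. ((\<lambda>y. Q y w) has_derivative Q' w) (at x)"
    and a: "(a has_derivative a') (at x)"
  shows "((\<lambda>y. Q y (a y)) has_derivative (\<lambda>v. Q x (a' v) + Q' (a x) v)) (at x)"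
proof -
  obtain U where U: "open U" "x \<in> U" "\<And>y. y \<in> U \<Longrightarrow> linear (Q y)"
    using lin unfolding eventually_nhds by blast
  have expand: "L w = (\<Sum>b\<in>Basis. (w \<bullet> b) *\<^sub>R L b)" if "linear L" for L :: "'b \<Rightarrow> 'c" and w
  proof -
    have "L w = L (\<Sum>b\<in>Basis. (w \<bullet> b) *\<^sub>R b)" by (simp add: euclidean_representation)
    also have "\<dots> = (\<Sum>b\<in>Basis. (w \<bullet> b) *\<^sub>R L b)"
      by (simp add: linear_sum[OF that] linear_scale[OF that])
    finally show ?thesis .
  qed
  have "linear (\<lambda>w. Q' w v)" for v
  proof (rule linearI)
    fix w1 w2
    have "((\<lambda>y. Q y w1 + Q y w2) has_derivative (\<lambda>v. Q' w1 v + Q' w2 v)) (at x)"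
      by (intro has_derivative_add Q)
    then have "((\<lambda>y. Q y (w1 + w2)) has_derivative (\<lambda>v. Q' w1 v + Q' w2 v)) (at x)"
      by (rule has_derivative_transform_within_open[OF _ U(1,2)]) (simp add: U(3) linear_add)
    then show "Q' (w1 + w2) v = Q' w1 v + Q' w2 v"
      using has_derivative_unique[OF Q] by metis
  next
    fix r w
    have "((\<lambda>y. r *\<^sub>R Q y w) has_derivative (\<lambda>v. r *\<^sub>R Q' w v)) (at x)"
      by (intro has_derivative_scaleR_right Q)
    then have "((\<lambda>y. Q y (r *\<^sub>R w)) has_derivative (\<lambda>v. r *\<^sub>R Q' w v)) (at x)"
      by (rule has_derivative_transform_within_open[OF _ U(1,2)]) (simp add: U(3) linear_scale)
    then show "Q' (r *\<^sub>R w) v = r *\<^sub>R Q' w v"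
      using has_derivative_unique[OF Q] by metis
  qed
  note expand' = expand[OF this]
  have "((\<lambda>y. \<Sum>b\<in>Basis. (a y \<bullet> b) *\<^sub>R Q y b) has_derivative
      (\<lambda>v. \<Sum>b\<in>Basis. (a x \<bullet> b) *\<^sub>R Q' b v + (a' v \<bullet> b) *\<^sub>R Q x b)) (at x)"
    by (intro has_derivative_sum has_derivative_scaleR has_derivative_inner_left a Q)
  then have "((\<lambda>y. Q y (a y)) has_derivative
      (\<lambda>v. \<Sum>b\<in>Basis. (a x \<bullet> b) *\<^sub>R Q' b v + (a' v \<bullet> b) *\<^sub>R Q x b)) (at x)"
    by (rule has_derivative_transform_within_open[OF _ U(1,2)]) (simp add: expand[OF U(3), symmetric])
  then show ?thesis
    by (simp add: sum.distrib expand[OF U(3)[OF U(2)], symmetric] expand'[symmetric] add.commute)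
qed


section \<open>Cyclic brackets and orbits of maximal length\<close>

locale real_inner_form =
  fixes ip :: "'e::euclidean_space \<Rightarrow> 'e \<Rightarrow> real"
  assumes bilin: "bilinear ip"
    and sym: "ip u v = ip v u"
    and pos: "u \<noteq> 0 \<Longrightarrow> ip u u > 0"
begin

lemma bounded: "bounded_bilinear ip"
  using bilin bilinear_conv_bounded_bilinear by blast

lemma nonneg: "ip u u \<ge> 0"
  using pos[of u] bounded_bilinear.zero_left[OF bounded] by (cases "u = 0") force+

text \<open>With \<open>K = \<parallel>L\<parallel>\<^sup>2\<close> for the operator norm of the inner product, Cauchy-Schwarz bounds the
  right-hand side by \<open>K \<bar>x\<bar>\<^sup>2\<close>. At a unit vector where the norm is attained the hypothesis becomes
  \<open>2 K \<le> K\<close>.\<close>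

lemma linear_eq_0_of_square_bound:
  fixes L :: "'e \<Rightarrow> 'e"
  assumes L: "linear L" and le: "\<And>x. 2 * ip (L x) (L x) \<le> ip (L (L x)) x"
  shows "L x = 0"
proof -
  interpret ip: bounded_bilinear ip by (rule bounded)
  define q where "q x = ip (L x) (L x) / ip x x" for x
  have "compact (sphere 0 1 :: 'e set)" by (rule compact_sphere)
  moreover have "sphere 0 1 \<noteq> ({} :: 'e set)" by simp
  moreover have "continuous_on (sphere 0 1) q"
    unfolding q_def
  proof (intro continuous_on_divide ip.continuous_on linear_continuous_on linear_linear[THEN iffD2, OF L]
          continuous_on_id' ballI bounded_linear_ident)
    show "ip x x \<noteq> 0" if "x \<in> sphere 0 1" for x
      using pos[of x] that by (cases "x = 0") auto
  qed
  ultimately obtain m where m: "m \<in> sphere 0 1" "\<And>y. y \<in> sphere 0 1 \<Longrightarrow> q y \<le> q m"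
    by (metis continuous_attains_sup)
  define K where "K = q m"
  have bound: "ip (L x) (L x) \<le> K * ip x x" for x
  proof (cases "x = 0")
    case True
    then show ?thesis using linear_0[OF L] by (simp add: ip.zero_left)
  next
    case False
    let ?y = "x /\<^sub>R norm x"
    have "q ?y \<le> K" unfolding K_def using False by (intro m(2)) simp
    moreover have "q ?y = q x"
      using False by (simp add: q_def linear_scale[OF L] ip.scaleR_left ip.scaleR_right)
    ultimately show ?thesis using pos[OF False] by (simp add: q_def pos_divide_le_eq)
  qed
  have m0: "ip m m > 0" using m(1) by (intro pos) auto
  have Km: "ip (L m) (L m) = K * ip m m" using m0 by (simp add: K_def q_def)
  have K0: "K \<ge> 0" using m0 nonneg[of "L m"] by (simp add: K_def q_def)
  have "K = 0"
  proof (rule ccontr)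
    assume "K \<noteq> 0"
    then have K: "K > 0" using K0 by simp
    (* expanding this square gives the needed case of the Cauchy-Schwarz inequality *)
    have "0 \<le> ip (L (L m) - K *\<^sub>R m) (L (L m) - K *\<^sub>R m)" by (rule nonneg)
    also have "\<dots> = ip (L (L m)) (L (L m)) - 2 * K * ip (L (L m)) m + K * K * ip m m"
      by (simp add: ip.diff_left ip.diff_right ip.scaleR_left ip.scaleR_right sym[of m "L (L m)"] algebra_simps)
    finally have "2 * K * ip (L (L m)) m \<le> ip (L (L m)) (L (L m)) + K * K * ip m m" by simp
    also have "\<dots> \<le> K * (K * ip m m) + K * K * ip m m"
      using bound[of "L m"] by (simp add: Km)
    finally have "2 * K * ip (L (L m)) m \<le> 2 * K * (K * ip m m)" by (simp add: algebra_simps)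
    then have "ip (L (L m)) m \<le> K * ip m m" using K by (metis mult_le_cancel_left_pos mult_pos_pos zero_less_numeral)
    then have "2 * (K * ip m m) \<le> K * ip m m" using le[of m] by (simp only: Km)
    moreover have "K * ip m m > 0" using K m0 by simp
    ultimately show False by linarith
  qed
  then have "ip (L x) (L x) \<le> 0" using bound[of x] by simp
  then show ?thesis using pos[of "L x"] by force
qed

end

lemma second_derivative_le_0_at_max:
  fixes f :: "real \<Rightarrow> real"
  assumes e: "e > 0"
    and f: "\<And>t. \<bar>t\<bar> < e \<Longrightarrow> (f has_real_derivative f' t) (at t)"
    and f': "(f' has_real_derivative f'') (at 0)"
    and le: "\<And>t. \<bar>t\<bar> < e \<Longrightarrow> f t \<le> f 0"
  shows "f' 0 = 0" "f'' \<le> 0"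
proof -
  show 0: "f' 0 = 0"
    using f[of 0] e le by (intro DERIV_local_max[of f "f' 0" 0 e]) auto
  show "f'' \<le> 0"
  proof (rule ccontr)
    assume "\<not> f'' \<le> 0"
    then obtain d where d: "d > 0" "\<And>h. 0 < h \<Longrightarrow> h < d \<Longrightarrow> f' 0 < f' (0 + h)"
      using DERIV_pos_inc_right[OF f'] by auto
    define h where "h = min d e / 2"
    have h: "0 < h" "h < d" "h < e" using d(1) e by (auto simp: h_def)
    obtain z where "0 < z" "z < h" "f h - f 0 = (h - 0) * f' z"
      using MVT2[of 0 h f f'] h f by force
    then have "f h - f 0 > 0" using d(2)[of z] 0 h by simp
    then show False using le[of h] h by simp
  qed
qed

text \<open>Here \<open>A y\<close> stands for \<open>Ad\<close> at the group element with coordinates \<open>y\<close>, and \<open>lam y v\<close> for the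
  tangent vector \<open>v\<close> at that element, translated back to the identity from the left. The curve
  \<open>p + t X\<close> is a straight line in the chart and in general not a one-parameter subgroup; it
  contributes a multiple of \<open>ip (br (dlam X X) Y) Y\<close> to the second derivative of
  \<open>ip (A y Y) (A y Y)\<close>, and this term vanishes by the first order condition in the
  direction \<open>dlam X X\<close>.\<close>

lemma (in real_inner_form) bracket_eq_0_at_orbit_max:
  fixes br :: "'e \<Rightarrow> 'e \<Rightarrow> 'e" and A :: "'e \<Rightarrow> 'e \<Rightarrow> 'e"
    and lam :: "'e \<Rightarrow> 'e \<Rightarrow> 'e" and dlam :: "'e \<Rightarrow> 'e \<Rightarrow> 'e"
  assumes br: "bilinear br" and br_skew: "\<And>u v. br u v = - br v u"
    and cyclic: "\<And>u v w. ip (br u v) w + ip (br v w) u + ip (br w u) v = 0"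
    and B: "open B" "p \<in> B"
    and A_lin: "\<And>y. y \<in> B \<Longrightarrow> linear (A y)" and A0: "\<And>w. A p w = w"
    and A_der: "\<And>y w. y \<in> B \<Longrightarrow> ((\<lambda>y. A y w) has_derivative (\<lambda>v. A y (br (lam y v) w))) (at y)"
    and lam_lin: "\<And>y. y \<in> B \<Longrightarrow> linear (lam y)" and lam0: "\<And>v. lam p v = v"
    and lam_der: "\<And>v. ((\<lambda>y. lam y v) has_derivative dlam v) (at p)"
    and le: "\<And>y. y \<in> B \<Longrightarrow> ip (A y Y) (A y Y) \<le> ip Y Y"
  shows "br v Y = 0"
proof -
  interpret ip: bounded_bilinear ip by (rule bounded)
  interpret br: bounded_bilinear br using br bilinear_conv_bounded_bilinear by blast
  have key: "ip (br X Y) Y = 0 \<and>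
      ip (br X Y) (br X Y) + ip (br X (br X Y) + br (dlam X X) Y) Y \<le> 0" for X
  proof -
    define c where "c t = p + t *\<^sub>R X" for t :: real
    have c: "(c has_derivative (\<lambda>d. d *\<^sub>R X)) (at t)" for t
      unfolding c_def by (auto intro!: derivative_eq_intros)
    have c0: "c 0 = p" by (simp add: c_def)
    have "open (c -` B)"
      unfolding c_def by (intro open_vimage B(1) continuous_intros)
    then obtain e where e: "e > 0" "\<And>t. \<bar>t\<bar> < e \<Longrightarrow> c t \<in> B"
      using B(2) c0 open_contains_ball[of "c -` B"] by (force simp: dist_real_def)
    define f where "f t = ip (A (c t) Y) (A (c t) Y)" for t
    define f' where "f' t = 2 * ip (A (c t) Y) (A (c t) (br (lam (c t) X) Y))" for t
    have Ac: "((\<lambda>t. A (c t) w) has_derivative (\<lambda>d. A (c t) (br (lam (c t) (d *\<^sub>R X)) w))) (at t)"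
      if "\<bar>t\<bar> < e" for t w
      using has_derivative_compose[OF c A_der[OF e(2)[OF that]]] .
    have lamX: "lam y (d *\<^sub>R X) = d *\<^sub>R lam y X" if "y \<in> B" for d y
      by (rule linear_scale[OF lam_lin[OF that]])
    have f: "(f has_real_derivative f' t) (at t)" if "\<bar>t\<bar> < e" for t
      unfolding f_def has_field_derivative_def
      by (rule has_derivative_eq_rhs[OF ip.FDERIV[OF Ac[OF that] Ac[OF that]]])
         (use linear_scale[OF A_lin[OF e(2)[OF that]]] in
           \<open>auto simp: f'_def lamX[OF e(2)[OF that]] br.scaleR_left ip.scaleR_left ip.scaleR_right sym[of _ "A (c t) Y"] fun_eq_iff\<close>)
    have lamc: "((\<lambda>t. br (lam (c t) X) Y) has_derivative (\<lambda>d. br (dlam X (d *\<^sub>R X)) Y)) (at 0)"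
      using has_derivative_compose[OF c lam_der[of X, folded c0]]
      by (auto intro!: br.FDERIV[THEN has_derivative_eq_rhs] derivative_eq_intros simp: br.zero_right)
    have lin: "\<forall>\<^sub>F t in nhds 0. linear (A (c t))"
      using e A_lin unfolding eventually_nhds_metric by (auto simp: dist_real_def)
    have "((\<lambda>t. A (c t) (br (lam (c t) X) Y)) has_derivative
        (\<lambda>d. A (c 0) (br (dlam X (d *\<^sub>R X)) Y) + A (c 0) (br (lam (c 0) (d *\<^sub>R X)) (br (lam (c 0) X) Y)))) (at 0)"
      using has_derivative_linear_family_apply[OF lin Ac lamc] e(1) by simp
    then have A2: "((\<lambda>t. A (c t) (br (lam (c t) X) Y)) has_derivative
        (\<lambda>d. d *\<^sub>R (br (dlam X X) Y + br X (br X Y)))) (at 0)"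
      by (simp add: c0 A0 lam0 linear_scale[OF has_derivative_linear[OF lam_der]] br.scaleR_left scaleR_add_right)
    have A1: "((\<lambda>t. A (c t) Y) has_derivative (\<lambda>d. d *\<^sub>R br X Y)) (at 0)"
      using Ac[of 0 Y] e(1) by (simp add: c0 A0 lam0 br.scaleR_left)
    define f'' where "f'' = 2 * (ip Y (br (dlam X X) Y + br X (br X Y)) + ip (br X Y) (br X Y))"
    have "(f' has_real_derivative f'') (at 0)"
      unfolding f'_def has_field_derivative_def
      by (rule has_derivative_eq_rhs[OF has_derivative_mult_right[OF ip.FDERIV[OF A1 A2]]])
         (auto simp: f''_def c0 A0 lam0 ip.add_right ip.scaleR_left ip.scaleR_right fun_eq_iff algebra_simps)
    from second_derivative_le_0_at_max[OF e(1) f this]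
    have "f' 0 = 0" "f'' \<le> 0"
      using le[OF e(2)] by (auto simp: f_def c0 A0)
    then show ?thesis
      by (auto simp: f'_def f''_def c0 A0 lam0 sym[of Y] algebra_simps)
  qed
  show ?thesis
  proof (rule linear_eq_0_of_square_bound[where L="\<lambda>x. br x Y"])
    show "linear (\<lambda>x. br x Y)" using br by (simp add: bilinear_def)
    fix x
    (* the first order condition for dlam x x removes the term that is due to the choice of curve *)
    have "ip (br x Y) (br x Y) + ip (br x (br x Y)) Y \<le> 0"
      using key[of x] key[of "dlam x x"] by (simp add: ip.add_left)
    moreover have "ip (br x (br x Y)) Y + ip (br (br x Y) Y) x + ip (br Y x) (br x Y) = 0"
      by (rule cyclic)
    moreover have "ip (br Y x) (br x Y) = - ip (br x Y) (br x Y)"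
      by (simp add: br_skew[of Y x] ip.minus_left)
    ultimately show "2 * ip (br x Y) (br x Y) \<le> ip (br (br x Y) Y) x" 
      by linarith
  qed
qed


section \<open>Differentiable maps in charts\<close>

locale manifold =
  fixes T :: "'p topology" and A :: "('p, 'e::euclidean_space) chart set"
  assumes smooth_manifold: "smooth_manifold T A"
begin

text \<open>The differential of \<open>f\<close> at \<open>p\<close>, read in the charts \<open>c\<close> around \<open>p\<close> and \<open>d\<close> around \<open>f p\<close>.\<close>

abbreviation D :: "('p, 'e) chart \<Rightarrow> ('p, 'e) chart \<Rightarrow> ('p \<Rightarrow> 'p) \<Rightarrow> 'p \<Rightarrow> 'e \<Rightarrow> 'e" where
  "D c d f p \<equiv> frechet_derivative (snd d \<circ> f \<circ> chart_inv c) (at (snd c p))"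

lemma is_chart: "c \<in> A \<Longrightarrow> is_chart T c"
  using smooth_manifold by (simp add: smooth_manifold_def)

lemma chart_at: "p \<in> topspace T \<Longrightarrow> \<exists>c\<in>A. p \<in> fst c"
  using smooth_manifold by (auto simp: smooth_manifold_def)

lemma openin_domain: "c \<in> A \<Longrightarrow> openin T (fst c)"
  using is_chart by (simp add: is_chart_def)

lemma domain_subset: "c \<in> A \<Longrightarrow> p \<in> fst c \<Longrightarrow> p \<in> topspace T"
  using openin_domain openin_subset by blast

lemma topspace_domain: "c \<in> A \<Longrightarrow> topspace (subtopology T (fst c)) = fst c"
  using openin_subset[OF openin_domain, of c] by auto

lemma homeo: "c \<in> A \<Longrightarrow> homeomorphic_map (subtopology T (fst c)) (top_of_set (snd c ` fst c)) (snd c)"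
  using is_chart by (simp add: is_chart_def)

lemma open_range: "c \<in> A \<Longrightarrow> open (snd c ` fst c)"
  using is_chart by (simp add: is_chart_def)

lemma inj_chart: "c \<in> A \<Longrightarrow> inj_on (snd c) (fst c)"
  using homeomorphic_imp_injective_map[OF homeo] topspace_domain by metis

lemma chart_inv_chart [simp]: "c \<in> A \<Longrightarrow> p \<in> fst c \<Longrightarrow> chart_inv c (snd c p) = p"
  by (simp add: chart_inv_def inj_chart)

lemma chart_inv_in: "y \<in> snd c ` fst c \<Longrightarrow> chart_inv c y \<in> fst c"
  by (simp add: chart_inv_def inv_into_into)

lemma chart_chart_inv: "y \<in> snd c ` fst c \<Longrightarrow> snd c (chart_inv c y) = y"
  by (simp add: chart_inv_def f_inv_into_f)

lemma open_chart_image: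
  assumes "c \<in> A" "openin T W" "W \<subseteq> fst c"
  shows "open (snd c ` W)"
proof -
  have "openin (subtopology T (fst c)) W"
    using assms by (simp add: openin_open_subtopology openin_domain)
  then have "openin (top_of_set (snd c ` fst c)) (snd c ` W)"
    using homeomorphic_imp_open_map[OF homeo[OF assms(1)]] by (simp add: open_map_def)
  then show ?thesis using openin_open_trans open_range[OF assms(1)] by blast
qed

lemma continuous_map_chart: "c \<in> A \<Longrightarrow> continuous_map (subtopology T (fst c)) euclidean (snd c)"
  using homeomorphic_imp_continuous_map[OF homeo] continuous_map_into_fulltopology by blast

lemma openin_chart_preimage:
  assumes "c \<in> A" "open V"
  shows "openin T {p \<in> fst c. snd c p \<in> V}"
  using openin_continuous_map_preimage[OF continuous_map_chart[OF assms(1)], of V] assms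
  by (simp only: topspace_domain openin_open_subtopology openin_domain open_openin)

lemma openin_preimage_domain:
  assumes "continuous_map T T f" "c \<in> A" "d \<in> A"
  shows "openin T {x \<in> fst c. f x \<in> fst d}"
proof -
  have "{x \<in> fst c. f x \<in> fst d} = fst c \<inter> {x \<in> topspace T. f x \<in> fst d}"
    using domain_subset[OF assms(2)] by blast
  then show ?thesis
    using openin_continuous_map_preimage[OF assms(1) openin_domain[OF assms(3)]] openin_domain[OF assms(2)]
    by (simp add: openin_Int)
qed

text \<open>The chain rule through an intermediate chart. The last map may have values in any normed space,
  because it is applied both to coordinate maps and to \<open>Ad\<close>, which takes values in the model space.\<close>

lemma has_derivative_through_chart:
  assumes f: "continuous_map T T f" and c: "c \<in> A" "p \<in> fst c" and d: "d \<in> A" "f p \<in> fst d"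
    and L: "((snd d \<circ> f \<circ> chart_inv c) has_derivative L) (at (snd c p))"
    and M: "((h \<circ> chart_inv d) has_derivative M) (at (snd d (f p)))"
  shows "((h \<circ> f \<circ> chart_inv c) has_derivative (\<lambda>v. M (L v))) (at (snd c p))"
proof -
  let ?W = "snd c ` {x \<in> fst c. f x \<in> fst d}"
  have "((\<lambda>y. (\<lambda>z. h (chart_inv d z)) ((snd d \<circ> f \<circ> chart_inv c) y)) has_derivative (\<lambda>v. M (L v))) (at (snd c p))"
    by (rule has_derivative_compose[OF L]) (use M c in \<open>simp add: comp_def\<close>)
  then show ?thesis
  proof (rule has_derivative_transform_within_open)
    show "open ?W" using openin_preimage_domain[OF f c(1) d(1)] c by (intro open_chart_image) auto
    show "snd c p \<in> ?W" using c d by auto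
  qed (use c d in auto)
qed

text \<open>Differentiability is enough for the maps of the manifold into itself: second derivatives are taken
  only of the multiplication in charts and of changes of coordinates. Demanding it for all pairs of
  charts makes it stable under composition.\<close>

definition diffable :: "('p \<Rightarrow> 'p) \<Rightarrow> bool" where
  "diffable f \<longleftrightarrow> continuous_map T T f \<and>
     (\<forall>c\<in>A. \<forall>d\<in>A. \<forall>p. p \<in> fst c \<and> f p \<in> fst d \<longrightarrow>
        (snd d \<circ> f \<circ> chart_inv c) differentiable (at (snd c p)))"

lemma diffable_continuous: "diffable f \<Longrightarrow> continuous_map T T f"
  by (simp add: diffable_def)

lemma diffable_has_derivative:
  "\<lbrakk>diffable f; c \<in> A; d \<in> A; p \<in> fst c; f p \<in> fst d\<rbrakk> \<Longrightarrow>
   ((snd d \<circ> f \<circ> chart_inv c) has_derivative D c d f p) (at (snd c p))"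
  unfolding diffable_def using frechet_derivative_works by blast

lemma linear_D: "\<lbrakk>diffable f; c \<in> A; d \<in> A; p \<in> fst c; f p \<in> fst d\<rbrakk> \<Longrightarrow> linear (D c d f p)"
  using diffable_has_derivative has_derivative_linear by blast

lemma diffable_maps: "diffable f \<Longrightarrow> p \<in> topspace T \<Longrightarrow> f p \<in> topspace T"
  using diffable_continuous continuous_map_image_subset_topspace by fastforce

lemma chain_rule_has_derivative:
  assumes "diffable f" "diffable h" and "c \<in> A" "p \<in> fst c" "d \<in> A" "f p \<in> fst d" "e \<in> A" "h (f p) \<in> fst e"
  shows "((snd e \<circ> (\<lambda>x. h (f x)) \<circ> chart_inv c) has_derivative (\<lambda>v. D d e h (f p) (D c d f p v))) (at (snd c p))"
  using has_derivative_through_chart[OF diffable_continuous[OF assms(1)] assms(3-6)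
      diffable_has_derivative[OF assms(1)] diffable_has_derivative[OF assms(2)], of e] assms(3-)
  by (simp add: comp_def)

lemma chain_rule:
  assumes "diffable f" "diffable h" and "c \<in> A" "p \<in> fst c" "d \<in> A" "f p \<in> fst d" "e \<in> A" "h (f p) \<in> fst e"
  shows "D c e (\<lambda>x. h (f x)) p v = D d e h (f p) (D c d f p v)"
  using frechet_derivative_eqI[OF chain_rule_has_derivative[OF assms]] by simp

lemma diffable_compose:
  assumes f: "diffable f" and h: "diffable h"
  shows "diffable (\<lambda>x. h (f x))"
  unfolding diffable_def
proof (intro conjI ballI allI impI)
  show "continuous_map T T (\<lambda>x. h (f x))"
    using continuous_map_compose[OF diffable_continuous[OF f] diffable_continuous[OF h]] by (simp add: comp_def)
  fix c e p assume c: "c \<in> A" and e: "e \<in> A" and p: "p \<in> fst c \<and> h (f p) \<in> fst e"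
  obtain d where "d \<in> A" "f p \<in> fst d"
    using chart_at diffable_maps[OF f] domain_subset[OF c] p by blast
  then show "(snd e \<circ> (\<lambda>x. h (f x)) \<circ> chart_inv c) differentiable (at (snd c p))"
    using chain_rule_has_derivative[OF f h c _ _ _ e] p unfolding differentiable_def by blast
qed

lemma D_cong_has_derivative:
  assumes "diffable f" "\<And>x. x \<in> topspace T \<Longrightarrow> f x = h x" "c \<in> A" "d \<in> A" "p \<in> fst c" "f p \<in> fst d"
  shows "((snd d \<circ> h \<circ> chart_inv c) has_derivative D c d f p) (at (snd c p))"
proof (rule has_derivative_transform_within_open[OF diffable_has_derivative[OF assms(1,3-6)]])
  show "open (snd c ` fst c)" using assms open_range by simp
  fix y assume "y \<in> snd c ` fst c"
  then show "(snd d \<circ> f \<circ> chart_inv c) y = (snd d \<circ> h \<circ> chart_inv c) y"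
    using assms(2,3) domain_subset[OF assms(3)] chart_inv_in by force
qed (use assms in auto)

lemma D_cong:
  assumes "diffable f" "\<And>x. x \<in> topspace T \<Longrightarrow> f x = h x" "c \<in> A" "d \<in> A" "p \<in> fst c" "f p \<in> fst d"
  shows "D c d h p = D c d f p"
  by (rule frechet_derivative_eqI[OF D_cong_has_derivative[OF assms]])

lemma smooth_map_imp_diffable:
  assumes "smooth_map T A T A f"
  shows "diffable f"
  unfolding diffable_def
proof (intro conjI ballI allI impI)
  show "continuous_map T T f" using assms by (simp add: smooth_map_def)
  fix c d p assume "c \<in> A" "d \<in> A" "p \<in> fst c \<and> f p \<in> fst d"
  then show "(snd d \<circ> f \<circ> chart_inv c) differentiable (at (snd c p))"
    using assms smooth_on_has_derivative[of "snd c ` {p \<in> fst c. f p \<in> fst d}" "snd d \<circ> f \<circ> chart_inv c" "snd c p"]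
    by (auto simp: smooth_map_def differentiable_def)
qed

lemma smooth_transition:
  "c \<in> A \<Longrightarrow> d \<in> A \<Longrightarrow> smooth_on (snd c ` (fst c \<inter> fst d)) (snd d \<circ> chart_inv c)"
  using smooth_manifold by (simp add: smooth_manifold_def)

lemma diffable_ident: "diffable (\<lambda>x. x)"
proof (rule smooth_map_imp_diffable)
  have "{p \<in> fst c. p \<in> fst d} = fst c \<inter> fst d" for c d :: "('p, 'e) chart" by auto
  then show "smooth_map T A T A (\<lambda>x. x)"
    using smooth_transition by (simp add: smooth_map_def comp_def)
qed

lemma D_ident: "c \<in> A \<Longrightarrow> p \<in> fst c \<Longrightarrow> D c c (\<lambda>x. x) p v = v"
proof -
  assume c: "c \<in> A" "p \<in> fst c"
  have "((snd c \<circ> (\<lambda>x. x) \<circ> chart_inv c) has_derivative (\<lambda>v. v)) (at (snd c p))"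
    by (rule has_derivative_transform_within_open[OF has_derivative_ident open_range[OF c(1)]])
       (use c in auto)
  then show ?thesis using frechet_derivative_eqI by metis
qed

lemma diffable_const: "a \<in> topspace T \<Longrightarrow> diffable (\<lambda>x. a)"
  unfolding diffable_def by (simp add: comp_def)

lemma D_const: "D c d (\<lambda>x. a) p v = 0"
  by (simp add: comp_def)

lemma tangent_space_eqI:
  assumes "u \<in> tangent_space A p" "v \<in> tangent_space A p" "c \<in> A" "p \<in> fst c" "u c = v c"
  shows "u = v"
proof
  fix d
  show "u d = v d"
  proof (cases "d \<in> A \<and> p \<in> fst d")
    case True
    then have "w d = frechet_derivative (snd d \<circ> chart_inv c) (at (snd c p)) (w c)"
      if "w \<in> tangent_space A p" for w
      using that assms(3,4) unfolding tangent_space_def by blast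
    from this[OF assms(1)] this[OF assms(2)] show ?thesis using assms(5) by simp
  next
    case False
    then have "w d = 0" if "w \<in> tangent_space A p" for w
      using that unfolding tangent_space_def by blast
    from this[OF assms(1)] this[OF assms(2)] show ?thesis by simp
  qed
qed

text \<open>Differentiating \<open>Y\<^sub>d (\<psi> y) = D\<psi>(y) (Y\<^sub>c y)\<close>, for the change of coordinates \<open>\<psi>\<close>, in the direction
  \<open>X\<^sub>c\<close> produces the term \<open>D\<^sup>2\<psi>(X\<^sub>c, Y\<^sub>c)\<close>. It is symmetric, so it cancels in the bracket, which
  therefore transforms like a tangent vector. This is what allows an inner product on the tangent
  space to be applied to a bracket.\<close>

lemma lie_bracket_in_tangent_space:
  assumes X: "smooth_vector_field A X" and Y: "smooth_vector_field A Y"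
  shows "lie_bracket A X Y p \<in> tangent_space A p"
  unfolding tangent_space_def
proof (intro CollectI conjI allI impI ballI)
  fix c assume "\<not> (c \<in> A \<and> p \<in> fst c)"
  then show "lie_bracket A X Y p c = 0" by (auto simp: lie_bracket_def)
next
  fix c d assume c: "c \<in> A" and d: "d \<in> A" and "p \<in> fst c \<and> p \<in> fst d"
  then have p: "p \<in> fst c" "p \<in> fst d" by auto
  define \<psi> where "\<psi> = snd d \<circ> chart_inv c"
  define S where "S = snd c ` (fst c \<inter> fst d)"
  define H where "H w = frechet_derivative (\<lambda>y. frechet_derivative \<psi> (at y) w) (at (snd c p))" for w
  have S: "open S" "snd c p \<in> S"
    unfolding S_def using c p openin_Int[OF openin_domain[OF c] openin_domain[OF d]]
    by (auto intro!: open_chart_image)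
  have \<psi>: "smooth_on S \<psi>" using smooth_transition[OF c d] by (simp add: S_def \<psi>_def)
  have coord: "(coord_rep e Z has_derivative frechet_derivative (coord_rep e Z) (at (snd e p))) (at (snd e p))"
    if "smooth_vector_field A Z" "e \<in> A" "p \<in> fst e" for e Z
    using that by (intro smooth_on_has_derivative[of "snd e ` fst e"]) (auto simp: smooth_vector_field_def)
  have transform: "frechet_derivative (coord_rep d Z) (at (snd d p)) (frechet_derivative \<psi> (at (snd c p)) v)
     = frechet_derivative \<psi> (at (snd c p)) (frechet_derivative (coord_rep c Z) (at (snd c p)) v) + H (Z p c) v"
    if Z: "smooth_vector_field A Z" for Z v
  proof -
    have tr: "coord_rep d Z (\<psi> y) = frechet_derivative \<psi> (at y) (coord_rep c Z y)" if y: "y \<in> S" for y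
    proof -
      obtain q where q: "q \<in> fst c" "q \<in> fst d" "y = snd c q" using y by (auto simp: S_def)
      have "Z q \<in> tangent_space A q" using Z by (simp add: smooth_vector_field_def)
      then have "Z q d = frechet_derivative \<psi> (at (snd c q)) (Z q c)"
        using q c d unfolding tangent_space_def \<psi>_def by blast
      then show ?thesis using q c d by (simp add: coord_rep_def \<psi>_def)
    qed
    have pd: "\<psi> (snd c p) = snd d p" using p c by (simp add: \<psi>_def)
    have 1: "((\<lambda>y. coord_rep d Z (\<psi> y)) has_derivative
        (\<lambda>v. frechet_derivative (coord_rep d Z) (at (snd d p)) (frechet_derivative \<psi> (at (snd c p)) v))) (at (snd c p))"
      by (rule has_derivative_compose[OF smooth_on_has_derivative[OF \<psi> S(2)]])
         (use coord[OF Z d p(2)] pd in simp)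
    have "\<forall>\<^sub>F y in nhds (snd c p). linear (frechet_derivative \<psi> (at y))"
      using S smooth_on_linear_derivative[OF \<psi>] unfolding eventually_nhds by blast
    then have "((\<lambda>y. frechet_derivative \<psi> (at y) (coord_rep c Z y)) has_derivative
        (\<lambda>v. frechet_derivative \<psi> (at (snd c p)) (frechet_derivative (coord_rep c Z) (at (snd c p)) v)
           + H (coord_rep c Z (snd c p)) v)) (at (snd c p))"
      unfolding H_def
      by (rule has_derivative_linear_family_apply)
         (use smooth_on_has_derivative[OF smooth_on_directional_derivative[OF \<psi>] S(2)] coord[OF Z c p(1)] in auto)
    then have 2: "((\<lambda>y. coord_rep d Z (\<psi> y)) has_derivative
        (\<lambda>v. frechet_derivative \<psi> (at (snd c p)) (frechet_derivative (coord_rep c Z) (at (snd c p)) v)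
           + H (coord_rep c Z (snd c p)) v)) (at (snd c p))"
      by (rule has_derivative_transform_within_open[OF _ S]) (simp add: tr)
    have "coord_rep c Z (snd c p) = Z p c" using c p by (simp add: coord_rep_def)
    then show ?thesis using has_derivative_unique[OF 1 2] by metis
  qed
  have comp: "Z p d = frechet_derivative \<psi> (at (snd c p)) (Z p c)" if "smooth_vector_field A Z" for Z
    using that c d p unfolding smooth_vector_field_def tangent_space_def \<psi>_def by blast
  have lin: "linear (frechet_derivative \<psi> (at (snd c p)))"
    using smooth_on_linear_derivative[OF \<psi> S(2)] .
  have "H (Y p c) (X p c) = H (X p c) (Y p c)"
    unfolding H_def by (rule second_derivative_symmetric[OF S \<psi>])
  then have "lie_bracket A X Y p d = frechet_derivative \<psi> (at (snd c p)) (lie_bracket A X Y p c)"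
    using transform[OF X] transform[OF Y] comp[OF X] comp[OF Y] c d p
    by (simp add: lie_bracket_def linear_diff[OF lin])
  then show "lie_bracket A X Y p d
      = frechet_derivative (snd d \<circ> chart_inv c) (at (snd c p)) (lie_bracket A X Y p c)"
    by (simp add: \<psi>_def)
qed

end

section \<open>Lie groups in charts\<close>

locale lie_grp = group G + manifold T A
  for G :: "('p, 'm) monoid_scheme" (structure)
    and T :: "'p topology" and A :: "('p, 'e::euclidean_space) chart set" +
  assumes lie_group: "lie_group G T A"
begin

lemma topspace_eq: "topspace T = carrier G"
  using lie_group by (simp add: lie_group_def)

lemma domain_carrier: "c \<in> A \<Longrightarrow> p \<in> fst c \<Longrightarrow> p \<in> carrier G"
  using domain_subset topspace_eq by blast

lemma smooth_mult: "smooth_map (prod_topology T T) (prod_atlas A A) T A (\<lambda>(x, y). x \<otimes> y)"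
  using lie_group by (simp add: lie_group_def)

definition mult_rep where
  "mult_rep c d e = (\<lambda>(y, z). snd e (chart_inv c y \<otimes> chart_inv d z))"

definition mult_dom where
  "mult_dom c d e = {(snd c p, snd d q) | p q. p \<in> fst c \<and> q \<in> fst d \<and> p \<otimes> q \<in> fst e}"

lemma open_mult_dom:
  assumes "c \<in> A" "d \<in> A" "e \<in> A"
  shows "open (mult_dom c d e)"
proof (rule open_subopen[THEN iffD2], intro ballI)
  fix x assume "x \<in> mult_dom c d e"
  then obtain p q where pq: "x = (snd c p, snd d q)" "p \<in> fst c" "q \<in> fst d" "p \<otimes> q \<in> fst e"
    by (auto simp: mult_dom_def)
  have "continuous_map (prod_topology T T) T (\<lambda>(x, y). x \<otimes> y)"
    using smooth_mult by (simp add: smooth_map_def)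
  from openin_continuous_map_preimage[OF this openin_domain[OF assms(3)]]
  have "openin (prod_topology T T) {z \<in> topspace T \<times> topspace T. (\<lambda>(x, y). x \<otimes> y) z \<in> fst e}"
    by simp
  moreover have "(p, q) \<in> {z \<in> topspace T \<times> topspace T. (\<lambda>(x, y). x \<otimes> y) z \<in> fst e}"
    using pq domain_subset[OF assms(1)] domain_subset[OF assms(2)] by simp
  ultimately obtain U V where UV: "openin T U" "openin T V" "p \<in> U" "q \<in> V"
    "U \<times> V \<subseteq> {z \<in> topspace T \<times> topspace T. (\<lambda>(x, y). x \<otimes> y) z \<in> fst e}"
    unfolding openin_prod_topology_alt by meson
  let ?U = "U \<inter> fst c" and ?V = "V \<inter> fst d"
  have o: "open (snd c ` ?U)" "open (snd d ` ?V)"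
    by (rule open_chart_image[OF assms(1) openin_Int[OF UV(1) openin_domain[OF assms(1)]] Int_lower2]
             open_chart_image[OF assms(2) openin_Int[OF UV(2) openin_domain[OF assms(2)]] Int_lower2])+
  have x: "x \<in> snd c ` ?U \<times> snd d ` ?V" using pq UV by auto
  have sub: "snd c ` ?U \<times> snd d ` ?V \<subseteq> mult_dom c d e"
  proof
    fix z assume "z \<in> snd c ` ?U \<times> snd d ` ?V"
    then obtain p' q' where z: "z = (snd c p', snd d q')" "p' \<in> fst c" "q' \<in> fst d" "(p', q') \<in> U \<times> V"
      by auto
    with UV(5) have "p' \<otimes> q' \<in> fst e" by auto
    with z show "z \<in> mult_dom c d e" unfolding mult_dom_def by blast
  qed
  show "\<exists>W. open W \<and> x \<in> W \<and> W \<subseteq> mult_dom c d e"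
    by (intro exI[of _ "snd c ` ?U \<times> snd d ` ?V"] conjI open_Times o x sub)
qed

lemma smooth_mult_rep:
  assumes "c \<in> A" "d \<in> A" "e \<in> A"
  shows "smooth_on (mult_dom c d e) (mult_rep c d e)"
proof -
  let ?m = "\<lambda>(x, y). x \<otimes> y" and ?cd = "(fst c \<times> fst d, map_prod (snd c) (snd d))"
  have "?cd \<in> prod_atlas A A" using assms unfolding prod_atlas_def by blast
  then have *: "smooth_on (snd ?cd ` {p \<in> fst ?cd. ?m p \<in> fst e}) (snd e \<circ> ?m \<circ> chart_inv ?cd)"
    using smooth_mult assms(3) unfolding smooth_map_def by blast
  have dom: "snd ?cd ` {p \<in> fst ?cd. ?m p \<in> fst e} = mult_dom c d e"
    by (force simp: mult_dom_def)
  have "inj_on (map_prod (snd c) (snd d)) (fst c \<times> fst d)"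
    using inj_chart[OF assms(1)] inj_chart[OF assms(2)] by (simp add: map_prod_inj_on)
  then have inv: "chart_inv ?cd (snd c p, snd d q) = (p, q)" if "p \<in> fst c" "q \<in> fst d" for p q
    using that inv_into_f_f[of "map_prod (snd c) (snd d)" "fst c \<times> fst d" "(p, q)"]
    by (simp add: chart_inv_def)
  have "smooth_on (mult_dom c d e) (snd e \<circ> ?m \<circ> chart_inv ?cd)" using * dom by simp
  then show ?thesis
    by (rule smooth_on_cong[OF open_mult_dom[OF assms], rotated])
       (use assms inv in \<open>auto simp: mult_rep_def mult_dom_def\<close>)
qed

lemma mult_rep_has_derivative:
  assumes "c \<in> A" "d \<in> A" "e \<in> A" "p \<in> fst c" "q \<in> fst d" "p \<otimes> q \<in> fst e"
  shows "(mult_rep c d e has_derivative frechet_derivative (mult_rep c d e) (at (snd c p, snd d q)))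
    (at (snd c p, snd d q))"
proof (rule smooth_on_has_derivative[OF smooth_mult_rep[OF assms(1-3)]])
  show "(snd c p, snd d q) \<in> mult_dom c d e" using assms unfolding mult_dom_def by blast
qed

lemma continuous_map_mult:
  "continuous_map T T f \<Longrightarrow> continuous_map T T h \<Longrightarrow> continuous_map T T (\<lambda>x. f x \<otimes> h x)"
proof -
  assume "continuous_map T T f" "continuous_map T T h"
  then have "continuous_map T (prod_topology T T) (\<lambda>x. (f x, h x))"
    by (simp add: continuous_map_pairedI)
  then show ?thesis
    using continuous_map_compose[of T "prod_topology T T" "\<lambda>x. (f x, h x)" T "\<lambda>(x, y). x \<otimes> y"]
      smooth_mult by (simp add: smooth_map_def comp_def)
qed

lemma product_rule_has_derivative:
  assumes f: "diffable f" and h: "diffable h"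
    and "c \<in> A" "p \<in> fst c" "d \<in> A" "f p \<in> fst d" "d' \<in> A" "h p \<in> fst d'" "e \<in> A" "f p \<otimes> h p \<in> fst e"
  shows "((snd e \<circ> (\<lambda>x. f x \<otimes> h x) \<circ> chart_inv c) has_derivative
    (\<lambda>v. frechet_derivative (mult_rep d d' e) (at (snd d (f p), snd d' (h p))) (D c d f p v, D c d' h p v)))
    (at (snd c p))"
proof -
  let ?W = "snd c ` ({x \<in> fst c. f x \<in> fst d} \<inter> {x \<in> fst c. h x \<in> fst d'})"
  have "((\<lambda>y. mult_rep d d' e ((snd d \<circ> f \<circ> chart_inv c) y, (snd d' \<circ> h \<circ> chart_inv c) y)) has_derivative
    (\<lambda>v. frechet_derivative (mult_rep d d' e) (at (snd d (f p), snd d' (h p))) (D c d f p v, D c d' h p v)))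
    (at (snd c p))"
    by (rule has_derivative_compose[OF has_derivative_Pair[OF diffable_has_derivative[OF f] diffable_has_derivative[OF h]]])
       (use assms mult_rep_has_derivative in auto)
  then show ?thesis
  proof (rule has_derivative_transform_within_open)
    show "open ?W"
      using openin_preimage_domain[OF diffable_continuous[OF f]] openin_preimage_domain[OF diffable_continuous[OF h]] assms
      by (intro open_chart_image openin_Int) auto
    show "snd c p \<in> ?W" using assms by auto
    fix y assume "y \<in> ?W"
    then show "mult_rep d d' e ((snd d \<circ> f \<circ> chart_inv c) y, (snd d' \<circ> h \<circ> chart_inv c) y)
        = (snd e \<circ> (\<lambda>x. f x \<otimes> h x) \<circ> chart_inv c) y"
      using assms(3,5,7) by (auto simp: mult_rep_def)
  qed
qed

lemma product_rule:
  assumes f: "diffable f" and h: "diffable h"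
    and "c \<in> A" "p \<in> fst c" "d \<in> A" "f p \<in> fst d" "d' \<in> A" "h p \<in> fst d'" "e \<in> A" "f p \<otimes> h p \<in> fst e"
  shows "D c e (\<lambda>x. f x \<otimes> h x) p v =
    frechet_derivative (mult_rep d d' e) (at (snd d (f p), snd d' (h p))) (D c d f p v, D c d' h p v)"
  using frechet_derivative_eqI[OF product_rule_has_derivative[OF assms]] by simp

lemma diffable_mult:
  assumes f: "diffable f" and h: "diffable h"
  shows "diffable (\<lambda>x. f x \<otimes> h x)"
  unfolding diffable_def
proof (intro conjI ballI allI impI)
  show "continuous_map T T (\<lambda>x. f x \<otimes> h x)"
    by (intro continuous_map_mult diffable_continuous f h)
  fix c e p assume c: "c \<in> A" and e: "e \<in> A" and p: "p \<in> fst c \<and> f p \<otimes> h p \<in> fst e"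
  obtain d d' where "d \<in> A" "f p \<in> fst d" "d' \<in> A" "h p \<in> fst d'"
    using chart_at diffable_maps[OF f] diffable_maps[OF h] domain_subset[OF c] p by meson
  then show "(snd e \<circ> (\<lambda>x. f x \<otimes> h x) \<circ> chart_inv c) differentiable (at (snd c p))"
    using product_rule_has_derivative[OF f h c _ _ _ _ _ e] p unfolding differentiable_def by blast
qed

lemma diffable_inv: "diffable (\<lambda>x. inv x)"
  using lie_group by (auto simp: lie_group_def intro: smooth_map_imp_diffable)

lemma diffable_constant: "a \<in> carrier G \<Longrightarrow> diffable (\<lambda>x. a)"
  by (simp add: diffable_const topspace_eq)

lemma diffable_left: "a \<in> carrier G \<Longrightarrow> diffable (\<lambda>x. a \<otimes> x)"
  by (rule diffable_mult[OF diffable_constant diffable_ident])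

text \<open>A translate of \<open>N\<close> around a point lies either in \<open>H\<close> or outside \<open>H\<close>, so \<open>H\<close> is open and closed.\<close>

lemma connected_subgroup_eq_carrier:
  assumes T: "connected_space T" and H: "subgroup H G" and N: "openin T N" "\<one> \<in> N" "N \<subseteq> H"
  shows "H = carrier G"
proof -
  define nb where "nb x = {y \<in> topspace T. inv x \<otimes> y \<in> N}" for x
  have nb: "openin T (nb x)" "x \<in> nb x" if "x \<in> carrier G" for x
    using that openin_continuous_map_preimage[OF diffable_continuous[OF diffable_left] N(1), of "inv x"] N(2)
    by (auto simp: nb_def topspace_eq)
  have H_iff: "y \<in> H \<longleftrightarrow> x \<in> H" if x: "x \<in> carrier G" and y: "y \<in> nb x" for x y
  proof -
    have yG: "y \<in> carrier G" and h: "inv x \<otimes> y \<in> H" using y N(3) by (auto simp: nb_def topspace_eq)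
    have "x \<otimes> (inv x \<otimes> y) = y" using x yG by (simp add: m_assoc[symmetric])
    moreover have "y \<otimes> inv (inv x \<otimes> y) = x" using x yG by (simp add: inv_mult_group m_assoc[symmetric])
    ultimately show ?thesis
      using subgroup.m_closed[OF H] subgroup.m_inv_closed[OF H] h by metis
  qed
  have HG: "H \<subseteq> carrier G" by (rule subgroup.subset[OF H])
  have "openin T H"
  proof (rule openin_subopen[THEN iffD2], intro ballI)
    fix x assume "x \<in> H"
    then show "\<exists>U. openin T U \<and> x \<in> U \<and> U \<subseteq> H"
      using nb[of x] H_iff[of x] HG by (intro exI[of _ "nb x"]) auto
  qed
  moreover have "openin T (topspace T - H)"
  proof (rule openin_subopen[THEN iffD2], intro ballI)
    fix x assume x: "x \<in> topspace T - H"
    then show "\<exists>U. openin T U \<and> x \<in> U \<and> U \<subseteq> topspace T - H"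
      using nb[of x] H_iff[of x] topspace_eq by (intro exI[of _ "nb x"]) (auto simp: nb_def)
  qed
  ultimately have "H = {} \<or> H = topspace T"
    using T HG topspace_eq unfolding connected_space_clopen_in closedin_def by blast
  then show ?thesis using subgroup.one_closed[OF H] topspace_eq by auto
qed

lemma diffable_conj: "a \<in> carrier G \<Longrightarrow> diffable (\<lambda>x. a \<otimes> x \<otimes> inv a)"
  by (rule diffable_mult[OF diffable_left diffable_constant]) auto

lemma D_left_compose:
  assumes "a \<in> carrier G" "b \<in> carrier G" "c \<in> A" "p \<in> fst c" "d \<in> A" "b \<otimes> p \<in> fst d" "e \<in> A" "a \<otimes> (b \<otimes> p) \<in> fst e"
  shows "D c e (\<lambda>x. (a \<otimes> b) \<otimes> x) p v = D d e (\<lambda>x. a \<otimes> x) (b \<otimes> p) (D c d (\<lambda>x. b \<otimes> x) p v)"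
proof -
  have "D c e (\<lambda>x. (a \<otimes> b) \<otimes> x) p = D c e (\<lambda>x. a \<otimes> (b \<otimes> x)) p"
    by (rule D_cong[OF diffable_compose[OF diffable_left diffable_left]])
       (use assms topspace_eq m_assoc in auto)
  then show ?thesis
    using chain_rule[OF diffable_left[OF assms(2)] diffable_left[OF assms(1)] assms(3-8)] by simp
qed

end

section \<open>Left-invariant fields and their bracket\<close>

text \<open>The chart \<open>c\<close> around the identity identifies the tangent space there with the model space.\<close>

locale lie_grp_chart = lie_grp G T A
  for G :: "('p, 'm) monoid_scheme" (structure)
    and T :: "'p topology" and A :: "('p, 'e::euclidean_space) chart set" +
  fixes c :: "('p, 'e) chart"
  assumes c: "c \<in> A" and one_c: "\<one> \<in> fst c"
begin

abbreviation x0 :: "'e" where "x0 \<equiv> snd c \<one>"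

abbreviation F where "F \<equiv> mult_rep c c c"

abbreviation DF where "DF z \<equiv> frechet_derivative F (at z)"

lemma one_topspace: "\<one> \<in> carrier G" by simp

lemma dom_c: "p \<in> fst c \<Longrightarrow> p \<in> carrier G"
  using domain_carrier c by blast

definition left_field :: "'e \<Rightarrow> ('p, 'e) vfield" where
  "left_field w p d = (if d \<in> A \<and> p \<in> fst d then D c d (\<lambda>q. p \<otimes> q) \<one> w else 0)"

lemma left_field_tangent: "left_field w p \<in> tangent_space A p"
  unfolding tangent_space_def
proof (intro CollectI conjI allI impI ballI)
  fix d assume "\<not> (d \<in> A \<and> p \<in> fst d)"
  then show "left_field w p d = 0" by (auto simp: left_field_def)
next
  fix d e assume d: "d \<in> A" and e: "e \<in> A" and "p \<in> fst d \<and> p \<in> fst e"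
  then have p: "p \<in> fst d" "p \<in> fst e" "p \<in> carrier G" using domain_carrier by blast+
  have "D c e (\<lambda>q. p \<otimes> q) \<one> w = D d e (\<lambda>x. x) (p \<otimes> \<one>) (D c d (\<lambda>q. p \<otimes> q) \<one> w)"
    by (rule chain_rule[OF diffable_left diffable_ident]) (use c one_c d e p in auto)
  moreover have "snd e \<circ> (\<lambda>x. x) \<circ> chart_inv d = snd e \<circ> chart_inv d" by auto
  ultimately show "left_field w p e
      = frechet_derivative (snd e \<circ> chart_inv d) (at (snd d p)) (left_field w p d)"
    using d e p by (simp add: left_field_def)
qed

lemma D_left_eq_partial:
  assumes "d \<in> A" "e \<in> A" "p \<in> fst d" "q \<in> fst c" "p \<otimes> q \<in> fst e"
  shows "D c e (\<lambda>x. p \<otimes> x) q w = frechet_derivative (mult_rep d c e) (at (snd d p, snd c q)) (0, w)"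
  using product_rule[OF diffable_constant diffable_ident, of p c q d c e w] assms c D_ident[of c q]
    domain_carrier[of d p] by (simp add: D_const)

text \<open>In a chart \<open>d\<close> the field is a directional derivative of the multiplication, restricted to the
  slice on which the second factor is the identity; so it inherits smoothness of all orders.\<close>

lemma left_field_smooth: "smooth_vector_field A (left_field w)"
  unfolding smooth_vector_field_def
proof (intro conjI allI ballI left_field_tangent)
  fix d assume d: "d \<in> A"
  let ?m = "mult_rep d c d"
  have dom: "{y. (y, x0) \<in> mult_dom d c d} = snd d ` fst d" (is "?l = ?r")
  proof (intro equalityI subsetI)
    fix y assume "y \<in> ?r"
    then obtain p where "p \<in> fst d" "y = snd d p" by blast
    then show "y \<in> ?l"
      using one_c domain_carrier[OF d] unfolding mult_dom_def by force
  qed (auto simp: mult_dom_def)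
  have "smooth_on (mult_dom d c d) (\<lambda>z. frechet_derivative ?m (at z) (0, w))"
    by (rule smooth_on_directional_derivative[OF smooth_mult_rep[OF d c d]])
  then have "smooth_on (snd d ` fst d) (\<lambda>y. frechet_derivative ?m (at (y, x0)) (0, w))"
    using smooth_on_slice[OF open_mult_dom[OF d c d], where z=x0] dom by simp
  then show "smooth_on (snd d ` fst d) (coord_rep d (left_field w))"
  proof (rule smooth_on_cong[OF open_range[OF d], rotated])
    fix y assume "y \<in> snd d ` fst d"
    then obtain p where p: "p \<in> fst d" "y = snd d p" by blast
    then show "frechet_derivative ?m (at (y, x0)) (0, w) = coord_rep d (left_field w) y"
      using D_left_eq_partial[OF d d p(1) one_c] d domain_carrier[OF d]
      by (simp add: coord_rep_def left_field_def)
  qed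
qed

lemma left_field_in_lie_algebra: "left_field w \<in> lie_algebra G A"
  unfolding lie_algebra_def
proof (intro CollectI conjI ballI left_field_smooth)
  fix a p assume a: "a \<in> carrier G" and p: "p \<in> carrier G"
  define d where "d = (SOME d. d \<in> A \<and> p \<in> fst d)"
  have "\<exists>d. d \<in> A \<and> p \<in> fst d" using chart_at p topspace_eq by blast
  then have "d \<in> A \<and> p \<in> fst d" unfolding d_def by (rule someI_ex)
  then have d: "d \<in> A" "p \<in> fst d" by auto
  show "left_field w (a \<otimes> p) = differential A A (\<lambda>q. a \<otimes> q) p (left_field w p)"
  proof
    fix e
    show "left_field w (a \<otimes> p) e = differential A A (\<lambda>q. a \<otimes> q) p (left_field w p) e"
    proof (cases "e \<in> A \<and> a \<otimes> p \<in> fst e")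
      case True
      then have "D c e (\<lambda>x. (a \<otimes> p) \<otimes> x) \<one> w = D d e (\<lambda>x. a \<otimes> x) p (D c d (\<lambda>x. p \<otimes> x) \<one> w)"
        using D_left_compose[OF a p c one_c d(1), of e w] d p by simp
      then show ?thesis
        using True d unfolding differential_def d_def[symmetric] Let_def by (simp add: left_field_def)
    next
      case False
      then show ?thesis by (auto simp: differential_def left_field_def Let_def)
    qed
  qed
qed

lemma D_left_one: "D c c (\<lambda>x. \<one> \<otimes> x) \<one> v = v"
proof -
  have "D c c (\<lambda>x. \<one> \<otimes> x) \<one> = D c c (\<lambda>x. x) \<one>"
    by (rule D_cong[OF diffable_ident]) (use c one_c topspace_eq in auto)
  then show ?thesis using D_ident[OF c one_c] by simp
qed

lemma left_field_one: "left_field w \<one> c = w"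
  using D_left_one c one_c by (simp add: left_field_def)

lemma DF_mult_one: "p \<in> fst c \<Longrightarrow> DF (snd c p, x0) (w, 0) = w"
proof -
  assume p: "p \<in> fst c"
  have "D c c (\<lambda>x. x \<otimes> \<one>) p = D c c (\<lambda>x. x) p"
    by (rule D_cong[OF diffable_ident]) (use c p topspace_eq in auto)
  moreover have "D c c (\<lambda>x. x \<otimes> \<one>) p w = DF (snd c p, x0) (w, 0)"
    using product_rule[OF diffable_ident diffable_constant[OF one_topspace], of c p c c c w] p c one_c dom_c[OF p]
      D_ident[OF c p] by (simp add: D_const)
  ultimately show ?thesis using D_ident[OF c p] by simp
qed

lemma one_in_dom: "(x0, x0) \<in> mult_dom c c c"
  using one_c unfolding mult_dom_def by force

lemma linear_DF: "z \<in> mult_dom c c c \<Longrightarrow> linear (DF z)"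
  using smooth_on_linear_derivative[OF smooth_mult_rep[OF c c c]] .

lemma DF_one: "DF (x0, x0) (v, w) = v + w"
proof -
  have "DF (x0, x0) (v, w) = DF (x0, x0) (v, 0) + DF (x0, x0) (0, w)"
    using linear_add[OF linear_DF[OF one_in_dom], of "(v, 0)" "(0, w)"] by simp
  also have "DF (x0, x0) (0, w) = w"
    using D_left_eq_partial[OF c c one_c one_c] D_left_one one_c by simp
  finally show ?thesis using DF_mult_one[OF one_c] by simp
qed

lemma D_inv_one: "D c c (\<lambda>x. inv x) \<one> v = - v"
proof -
  have "D c c (\<lambda>x. x \<otimes> inv x) \<one> v = DF (x0, x0) (v, D c c (\<lambda>x. inv x) \<one> v)"
    using product_rule[OF diffable_ident diffable_inv, of c \<one> c c c v] c one_c D_ident[OF c one_c] by simp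
  moreover have "D c c (\<lambda>x. x \<otimes> inv x) \<one> = D c c (\<lambda>x. \<one>) \<one>"
    by (rule D_cong[OF diffable_constant]) (use c one_c topspace_eq in auto)
  ultimately have "v + D c c (\<lambda>x. inv x) \<one> v = 0" by (simp add: DF_one D_const)
  then show ?thesis by (simp add: add_eq_0_iff)
qed

text \<open>The second derivative of the multiplication at the identity. It is the symmetry of this form
  (\<open>DDF_sym\<close>) that identifies the bracket of left-invariant fields with the derivative of \<open>Ad\<close>.\<close>

definition DDF where "DDF a b = frechet_derivative (\<lambda>z. DF z a) (at (x0, x0)) b"

lemma DDF_has_derivative: "((\<lambda>z. DF z a) has_derivative DDF a) (at (x0, x0))"
  unfolding DDF_def
  using smooth_on_has_derivative[OF smooth_on_directional_derivative[OF smooth_mult_rep[OF c c c]] one_in_dom] .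

lemma DDF_sym: "DDF a b = DDF b a"
  unfolding DDF_def by (rule second_derivative_symmetric[OF open_mult_dom[OF c c c] one_in_dom smooth_mult_rep[OF c c c]])

lemma DDF_linear: "linear (DDF a)"
  using has_derivative_linear[OF DDF_has_derivative] .

lemma has_derivative_Pair_left: "((\<lambda>y. (y, z)) has_derivative (\<lambda>v. (v, 0))) (at y)"
  by (intro has_derivative_Pair has_derivative_ident has_derivative_const)

text \<open>Multiplication by the identity from the right is the identity map, which is linear in the chart.\<close>

lemma DDF_left_left: "DDF (w, 0) (v, 0) = 0"
proof -
  have "((\<lambda>y. DF (y, x0) (w, 0)) has_derivative (\<lambda>v. DDF (w, 0) (v, 0))) (at x0)"
    by (rule has_derivative_compose[OF has_derivative_Pair_left DDF_has_derivative])
  moreover have "((\<lambda>y. DF (y, x0) (w, 0)) has_derivative (\<lambda>v. 0)) (at x0)"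
    by (rule has_derivative_transform_within_open[OF has_derivative_const[of w] open_range[OF c]])
       (use one_c DF_mult_one in auto)
  ultimately show ?thesis using has_derivative_unique by metis
qed

definition bracket where "bracket v w = DDF (0, w) (v, 0) - DDF (0, v) (w, 0)"

lemma bracket_bilinear: "bilinear bracket"
proof -
  have "linear (\<lambda>x. DDF (0, x) (v, 0))" "linear (\<lambda>x. DDF (0, v) (x, 0))" for v
  proof -
    have *: "linear (\<lambda>x::'e. (0::'e, x))" "linear (\<lambda>x::'e. (x, 0::'e))"
      by (auto intro!: linearI)
    show "linear (\<lambda>x. DDF (0, v) (x, 0))"
      using linear_compose[OF *(2) DDF_linear] by (simp add: comp_def)
    show "linear (\<lambda>x. DDF (0, x) (v, 0))"
      using linear_compose[OF *(1) DDF_linear] by (subst DDF_sym) (simp add: comp_def)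
  qed
  then show ?thesis unfolding bilinear_def bracket_def by (intro conjI allI linear_compose_sub)
qed

lemma bracket_skew: "bracket u v = - bracket v u"
  by (simp add: bracket_def)

lemma coord_rep_left_field_has_derivative:
  "(coord_rep c (left_field w) has_derivative (\<lambda>v. DDF (0, w) (v, 0))) (at x0)"
proof (rule has_derivative_transform_within_open[OF has_derivative_compose[OF has_derivative_Pair_left DDF_has_derivative] open_range[OF c]])
  show "x0 \<in> snd c ` fst c" using one_c by blast
  fix y assume "y \<in> snd c ` fst c"
  then obtain p where p: "p \<in> fst c" "y = snd c p" by blast
  then show "DF (y, x0) (0, w) = coord_rep c (left_field w) y"
    using D_left_eq_partial[OF c c p(1) one_c] dom_c c by (simp add: coord_rep_def left_field_def)
qed

lemma lie_bracket_left_field: "lie_bracket A (left_field u) (left_field w) \<one> = left_field (bracket u w) \<one>"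
proof (rule tangent_space_eqI[OF lie_bracket_in_tangent_space[OF left_field_smooth left_field_smooth] left_field_tangent c one_c])
  show "lie_bracket A (left_field u) (left_field w) \<one> c = left_field (bracket u w) \<one> c"
    using c one_c frechet_derivative_eqI[OF coord_rep_left_field_has_derivative]
    by (simp add: lie_bracket_def left_field_one bracket_def)
qed

definition metric_form :: "_ \<Rightarrow> 'e \<Rightarrow> 'e \<Rightarrow> real" where
  "metric_form g u w = g \<one> (left_field u \<one>) (left_field w \<one>)"

lemma left_field_add: "left_field (u + v) \<one> = (\<lambda>d. left_field u \<one> d + left_field v \<one> d)"
  using linear_add[OF linear_D[OF diffable_left[OF one_topspace] c _ one_c]] by (auto simp: left_field_def fun_eq_iff)

lemma left_field_scale: "left_field (r *\<^sub>R u) \<one> = (\<lambda>d. r *\<^sub>R left_field u \<one> d)"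
  using linear_scale[OF linear_D[OF diffable_left[OF one_topspace] c _ one_c]] by (auto simp: left_field_def fun_eq_iff)

lemma real_inner_form_metric_form:
  assumes "riemannian_metric T A g"
  shows "real_inner_form (metric_form g)"
proof -
  have g: "inner_product_on (tangent_space A \<one>) (g \<one>)"
    using assms by (simp add: riemannian_metric_def topspace_eq)
  note gD = g[unfolded inner_product_on_def]
  have s: "metric_form g u v = metric_form g v u" for u v
    using gD left_field_tangent unfolding metric_form_def by blast
  have a: "metric_form g (u + v) w = metric_form g u w + metric_form g v w" for u v w
    using gD left_field_tangent unfolding metric_form_def left_field_add by blast
  have r: "metric_form g (r *\<^sub>R u) w = r *\<^sub>R metric_form g u w" for r u w
    using gD left_field_tangent unfolding metric_form_def left_field_scale real_scaleR_def by blast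
  show ?thesis
  proof
    show "metric_form g u v = metric_form g v u" for u v by (rule s)
    have "linear (\<lambda>x. metric_form g x v)" for v by (rule linearI) (simp_all only: a r)
    moreover from this have "linear (\<lambda>x. metric_form g v x)" for v by (subst s)
    ultimately show "bilinear (metric_form g)" unfolding bilinear_def by blast
    fix u :: 'e assume "u \<noteq> 0"
    then have "left_field u \<one> \<noteq> (\<lambda>c. 0)" using left_field_one[of u] by metis
    then show "metric_form g u u > 0" using gD left_field_tangent unfolding metric_form_def by blast
  qed
qed

lemma cyclic_bracket:
  assumes "cyclic_metric_lie_group G T A g"
  shows "metric_form g (bracket u v) w + metric_form g (bracket v w) u + metric_form g (bracket w u) v = 0"
  using assms left_field_in_lie_algebra
  unfolding cyclic_metric_lie_group_def lie_inner_def metric_form_def lie_bracket_left_field[symmetric] by blast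

section \<open>The adjoint representation\<close>

definition Ad :: "'p \<Rightarrow> 'e \<Rightarrow> 'e" where
  "Ad a = D c c (\<lambda>x. a \<otimes> x \<otimes> inv a) \<one>"

lemma linear_Ad: "a \<in> carrier G \<Longrightarrow> linear (Ad a)"
  unfolding Ad_def by (rule linear_D[OF diffable_conj]) (use c one_c in auto)

lemma Ad_one: "Ad \<one> w = w"
proof -
  have "Ad \<one> = D c c (\<lambda>x. x) \<one>"
    unfolding Ad_def by (rule D_cong[OF diffable_ident]) (use c one_c topspace_eq in auto)
  then show ?thesis using D_ident[OF c one_c] by simp
qed

lemma Ad_mult:
  assumes "a \<in> carrier G" "b \<in> carrier G"
  shows "Ad (a \<otimes> b) w = Ad a (Ad b w)"
proof -
  have "Ad (a \<otimes> b) = D c c (\<lambda>x. a \<otimes> (b \<otimes> x \<otimes> inv b) \<otimes> inv a) \<one>"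
    unfolding Ad_def
    by (rule D_cong[OF diffable_compose[OF diffable_conj diffable_conj]])
       (use assms c one_c topspace_eq in \<open>auto simp: m_assoc inv_mult_group\<close>)
  then show ?thesis
    using chain_rule[OF diffable_conj[OF assms(2)] diffable_conj[OF assms(1)] c one_c c _ c] assms one_c
    by (simp add: Ad_def)
qed

lemma Ad_eq_partials:
  assumes "p \<in> fst c" "inv p \<in> fst c"
  shows "Ad p w = DF (snd c p, snd c (inv p)) (DF (snd c p, x0) (0, w), 0)"
  unfolding Ad_def
  using product_rule[OF diffable_left[of p] diffable_constant[of "inv p"] c one_c c _ c _ c, of w]
    assms dom_c one_c D_left_eq_partial[OF c c assms(1) one_c] by (simp add: D_const)

definition inv_dom :: "'e set" where
  "inv_dom = snd c ` {p \<in> fst c. inv p \<in> fst c}"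

abbreviation inv_rep :: "'e \<Rightarrow> 'e" where
  "inv_rep y \<equiv> snd c (inv (chart_inv c y))"

lemma open_inv_dom: "open inv_dom"
  unfolding inv_dom_def
  using openin_preimage_domain[OF diffable_continuous[OF diffable_inv] c c] c by (intro open_chart_image) auto

lemma x0_inv_dom: "x0 \<in> inv_dom"
  unfolding inv_dom_def using one_c by force

lemma inv_dom_dest:
  assumes "y \<in> inv_dom"
  shows "y \<in> snd c ` fst c" "(y, inv_rep y) \<in> mult_dom c c c" "(inv_rep y, y) \<in> mult_dom c c c"
proof -
  obtain p where p: "p \<in> fst c" "inv p \<in> fst c" "y = snd c p"
    using assms unfolding inv_dom_def by blast
  moreover have "p \<otimes> inv p \<in> fst c" "inv p \<otimes> p \<in> fst c" using p(1) dom_c one_c by auto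
  ultimately show "y \<in> snd c ` fst c" "(y, inv_rep y) \<in> mult_dom c c c" "(inv_rep y, y) \<in> mult_dom c c c"
    unfolding mult_dom_def using c by auto
qed

lemma inv_rep_has_derivative: "(inv_rep has_derivative (\<lambda>v. - v)) (at x0)"
  using diffable_has_derivative[OF diffable_inv c c one_c] one_c D_inv_one[abs_def]
  by (simp add: comp_def)

text \<open>In coordinates \<open>Ad\<^sub>y w = D\<^sub>1F(y, y\<inverse>) (D\<^sub>2F(y, 1) w)\<close>. Differentiating the outer factor in the
  direction \<open>v\<close> gives \<open>DDF (w, 0) (v, - v) = - DDF (w, 0) (0, v)\<close>, since the inversion has derivative
  \<open>- id\<close>; differentiating the inner factor gives \<open>DDF (0, w) (v, 0)\<close>. By symmetry of \<open>DDF\<close> the sum is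
  the bracket.\<close>

lemma Ad_has_derivative_one:
  "((\<lambda>y. Ad (chart_inv c y) w) has_derivative (\<lambda>v. bracket v w)) (at x0)"
proof -
  have x0_inv: "(x0, inv_rep x0) = (x0, x0)" using c one_c by simp
  have pair: "((\<lambda>y. (y, inv_rep y)) has_derivative (\<lambda>v. (v, - v))) (at x0)"
    by (intro has_derivative_Pair has_derivative_ident inv_rep_has_derivative)
  have zero: "linear (\<lambda>u::'e. (u, 0::'e))" by (auto intro!: linearI)
  have lin: "\<forall>\<^sub>F y in nhds x0. linear (\<lambda>u. DF (y, inv_rep y) (u, 0))"
    unfolding eventually_nhds
  proof (intro exI[of _ inv_dom] conjI open_inv_dom x0_inv_dom ballI)
    fix y assume "y \<in> inv_dom"
    then show "linear (\<lambda>u. DF (y, inv_rep y) (u, 0))"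
      using linear_compose[OF zero linear_DF[OF inv_dom_dest(2)]] by (simp add: comp_def)
  qed
  have Q: "((\<lambda>y. DF (y, inv_rep y) (u, 0)) has_derivative (\<lambda>v. DDF (u, 0) (v, - v))) (at x0)" for u
    by (rule has_derivative_compose[OF pair]) (use DDF_has_derivative x0_inv in simp)
  have a: "((\<lambda>y. DF (y, x0) (0, w)) has_derivative (\<lambda>v. DDF (0, w) (v, 0))) (at x0)"
    by (rule has_derivative_compose[OF has_derivative_Pair_left DDF_has_derivative])
  have "((\<lambda>y. DF (y, inv_rep y) (DF (y, x0) (0, w), 0)) has_derivative
      (\<lambda>v. DF (x0, inv_rep x0) (DDF (0, w) (v, 0), 0) + DDF (DF (x0, x0) (0, w), 0) (v, - v))) (at x0)"
    by (rule has_derivative_linear_family_apply[OF lin Q a])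
  moreover have "DF (x0, inv_rep x0) (DDF (0, w) (v, 0), 0) + DDF (DF (x0, x0) (0, w), 0) (v, - v) = bracket v w" for v
  proof -
    have "(v, - v) = (v, 0) - (0, v)" by simp
    then have "DDF (w, 0) (v, - v) = - DDF (w, 0) (0, v)"
      using linear_diff[OF DDF_linear, of "(w, 0)" "(v, 0)" "(0, v)"] DDF_left_left[of w v] by (metis diff_0)
    then show ?thesis using DDF_sym[of "(w, 0)" "(0, v)"] by (simp only: x0_inv DF_one bracket_def) simp
  qed
  ultimately have "((\<lambda>y. DF (y, inv_rep y) (DF (y, x0) (0, w), 0)) has_derivative (\<lambda>v. bracket v w)) (at x0)"
    by simp
  then show ?thesis
  proof (rule has_derivative_transform_within_open[OF _ open_inv_dom x0_inv_dom])
    fix y assume "y \<in> inv_dom"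
    then obtain p where p: "p \<in> fst c" "inv p \<in> fst c" "y = snd c p"
      unfolding inv_dom_def by blast
    then show "DF (y, inv_rep y) (DF (y, x0) (0, w), 0) = Ad (chart_inv c y) w"
      using Ad_eq_partials[OF p(1,2)] c by simp
  qed
qed

text \<open>The left logarithmic derivative: a tangent vector at the point with coordinates \<open>y\<close> is moved to
  the identity by left translation.\<close>

definition log_deriv :: "'e \<Rightarrow> 'e \<Rightarrow> 'e" where
  "log_deriv y = D c c (\<lambda>x. inv (chart_inv c y) \<otimes> x) (chart_inv c y)"

text \<open>Near \<open>p\<close> one has \<open>Ad\<^sub>q = Ad\<^sub>p Ad\<^sub>r\<close> with \<open>r = p\<inverse> q\<close> close to the identity, so the derivative at \<open>p\<close>
  follows from the derivative at the identity.\<close>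

lemma Ad_has_derivative:
  assumes "y \<in> snd c ` fst c"
  shows "((\<lambda>y. Ad (chart_inv c y) w) has_derivative (\<lambda>v. Ad (chart_inv c y) (bracket (log_deriv y v) w))) (at y)"
proof -
  define p where "p = chart_inv c y"
  have p: "p \<in> fst c" "snd c p = y" "p \<in> carrier G"
    using chart_inv_in[OF assms] chart_chart_inv[OF assms] dom_c by (auto simp: p_def)
  let ?h = "\<lambda>x. Ad p (Ad x w)"
  have "bounded_linear (Ad p)" using linear_Ad[OF p(3)] by (simp add: linear_conv_bounded_linear)
  then have 1: "((?h \<circ> chart_inv c) has_derivative (\<lambda>v. Ad p (bracket v w))) (at (snd c (inv p \<otimes> p)))"
    using bounded_linear.has_derivative[OF _ Ad_has_derivative_one] p(3) by (simp add: comp_def)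
  have "((?h \<circ> (\<lambda>x. inv p \<otimes> x) \<circ> chart_inv c) has_derivative
      (\<lambda>v. Ad p (bracket (D c c (\<lambda>x. inv p \<otimes> x) p v) w))) (at (snd c p))"
    by (rule has_derivative_through_chart[where f="\<lambda>x. inv p \<otimes> x" and h="?h", OF _ c p(1) c _ _ 1])
       (use p one_c c in \<open>auto intro!: diffable_continuous diffable_left diffable_has_derivative\<close>)
  then have "((?h \<circ> (\<lambda>x. inv p \<otimes> x) \<circ> chart_inv c) has_derivative (\<lambda>v. Ad p (bracket (log_deriv y v) w))) (at y)"
    using p by (simp add: log_deriv_def p_def[symmetric])
  then have "((\<lambda>y. Ad (chart_inv c y) w) has_derivative (\<lambda>v. Ad p (bracket (log_deriv y v) w))) (at y)"
  proof (rule has_derivative_transform_within_open[OF _ open_range[OF c] assms])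
    fix z assume "z \<in> snd c ` fst c"
    then have "chart_inv c z \<in> carrier G" by (rule dom_c[OF chart_inv_in])
    then show "(?h \<circ> (\<lambda>x. inv p \<otimes> x) \<circ> chart_inv c) z = Ad (chart_inv c z) w"
      using Ad_mult[OF p(3), of "inv p \<otimes> chart_inv c z" w] p(3) by (simp add: m_assoc[symmetric])
  qed
  then show ?thesis by (simp add: p_def)
qed

lemma linear_log_deriv:
  assumes "y \<in> snd c ` fst c"
  shows "linear (log_deriv y)"
proof -
  have "chart_inv c y \<in> fst c" "chart_inv c y \<in> carrier G"
    using chart_inv_in[OF assms] dom_c by auto
  then show ?thesis
    unfolding log_deriv_def by (intro linear_D diffable_left c) (use one_c in auto)
qed

lemma log_deriv_one: "log_deriv x0 v = v"
  using D_left_one c one_c by (simp add: log_deriv_def)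

lemma log_deriv_has_derivative:
  "((\<lambda>y. log_deriv y v) has_derivative (\<lambda>u. DDF (0, v) (- u, u))) (at x0)"
proof -
  have pair: "((\<lambda>y. (inv_rep y, y)) has_derivative (\<lambda>v. (- v, v))) (at x0)"
    by (intro has_derivative_Pair has_derivative_ident inv_rep_has_derivative)
  have "((\<lambda>y. DF (inv_rep y, y) (0, v)) has_derivative (\<lambda>u. DDF (0, v) (- u, u))) (at x0)"
    by (rule has_derivative_compose[OF pair]) (use DDF_has_derivative c one_c in simp)
  then show ?thesis
  proof (rule has_derivative_transform_within_open[OF _ open_inv_dom x0_inv_dom])
    fix y assume "y \<in> inv_dom"
    then obtain p where p: "p \<in> fst c" "inv p \<in> fst c" "y = snd c p"
      unfolding inv_dom_def by blast
    then show "DF (inv_rep y, y) (0, v) = log_deriv y v"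
      using D_left_eq_partial[OF c c p(2,1)] dom_c[OF p(1)] one_c c by (simp add: log_deriv_def)
  qed
qed

text \<open>Near the identity this is continuity in the chart \<open>c\<close>. Left translation by \<open>p\<close> carries it to a
  neighbourhood of \<open>p\<close>, where \<open>Ad\<close> changes by the linear map \<open>Ad p\<close>.\<close>

lemma continuous_map_Ad: "continuous_map T euclidean (\<lambda>a. Ad a w)"
proof -
  define N where "N p = {a \<in> topspace T. inv p \<otimes> a \<in> fst c}" for p
  have left: "continuous_map T T (\<lambda>a. inv p \<otimes> a)" if "p \<in> carrier G" for p
    using that by (intro diffable_continuous diffable_left) simp
  have N: "openin T (N p)" if "p \<in> carrier G" for p
    unfolding N_def by (rule openin_continuous_map_preimage[OF left[OF that] openin_domain[OF c]])
  have cont_chart: "continuous_map (subtopology T (fst c)) euclidean (\<lambda>a. Ad a w)"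
  proof -
    have "continuous_on (snd c ` fst c) (\<lambda>y. Ad (chart_inv c y) w)"
      by (intro continuous_at_imp_continuous_on ballI has_derivative_continuous[OF Ad_has_derivative])
    then have "continuous_map (top_of_set (snd c ` fst c)) euclidean (\<lambda>y. Ad (chart_inv c y) w)"
      by simp
    from continuous_map_compose[OF homeomorphic_imp_continuous_map[OF homeo[OF c]] this]
    show ?thesis by (rule continuous_map_eq) (use c in auto)
  qed
  have local: "continuous_map (subtopology T (N p)) euclidean (\<lambda>a. Ad a w)" if p: "p \<in> carrier G" for p
  proof -
    have "continuous_map (subtopology T (N p)) (subtopology T (fst c)) (\<lambda>a. inv p \<otimes> a)"
      using continuous_map_from_subtopology[OF left[OF p]] by (auto simp: continuous_map_in_subtopology N_def)
    from continuous_map_compose[OF this cont_chart]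
    have "continuous_map (subtopology T (N p)) euclidean (\<lambda>a. Ad (inv p \<otimes> a) w)" by (simp add: comp_def)
    moreover have "continuous_map euclidean euclidean (Ad p)"
      using linear_continuous_on[of "Ad p" UNIV] linear_Ad[OF p] by (simp add: linear_conv_bounded_linear)
    ultimately have "continuous_map (subtopology T (N p)) euclidean (Ad p \<circ> (\<lambda>a. Ad (inv p \<otimes> a) w))"
      by (rule continuous_map_compose)
    then show ?thesis
    proof (rule continuous_map_eq)
      fix a assume "a \<in> topspace (subtopology T (N p))"
      then have "a \<in> carrier G" using topspace_eq by simp
      then show "(Ad p \<circ> (\<lambda>a. Ad (inv p \<otimes> a) w)) a = Ad a w"
        using Ad_mult[OF p, of "inv p \<otimes> a" w] p by (simp add: m_assoc[symmetric])
    qed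
  qed
  show ?thesis
  proof (rule pasting_lemma[where I="carrier G" and T=N and f="\<lambda>_ a. Ad a w"])
    show "\<exists>j. j \<in> carrier G \<and> x \<in> N j \<and> Ad x w = Ad x w" if "x \<in> topspace T" for x
      using that one_c by (intro exI[of _ x]) (auto simp: N_def topspace_eq)
  qed (use N local in auto)
qed

lemma zero_derivative_imp_constant_near_one:
  fixes h :: "'p \<Rightarrow> 'z::real_normed_vector"
  assumes W: "openin T W" "\<one> \<in> W" "W \<subseteq> fst c"
    and h: "\<And>p. p \<in> W \<Longrightarrow> ((h \<circ> chart_inv c) has_derivative (\<lambda>v. 0)) (at (snd c p))"
  shows "\<exists>N. openin T N \<and> \<one> \<in> N \<and> N \<subseteq> W \<and> (\<forall>p\<in>N. h p = h \<one>)"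
proof -
  have "open (snd c ` W)" by (rule open_chart_image[OF c W(1,3)])
  then obtain r where r: "r > 0" "ball x0 r \<subseteq> snd c ` W"
    using W(2) openE by (metis imageI)
  have "h p = h \<one>" if p: "p \<in> fst c" "snd c p \<in> ball x0 r" for p
  proof -
    have "(h \<circ> chart_inv c) (snd c p) = (h \<circ> chart_inv c) x0"
    proof (rule has_derivative_zero_unique[OF convex_ball _ p(2)])
      fix y assume "y \<in> ball x0 r"
      then obtain q where "q \<in> W" "y = snd c q" using r(2) by blast
      then show "((h \<circ> chart_inv c) has_derivative (\<lambda>v. 0)) (at y within ball x0 r)"
        using h has_derivative_at_withinI by blast
    qed (use r in simp)
    then show ?thesis using c one_c p by simp
  qed
  then have const: "\<forall>p\<in>{p \<in> fst c. snd c p \<in> ball x0 r} \<inter> W. h p = h \<one>" by blast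
  have one: "\<one> \<in> {p \<in> fst c. snd c p \<in> ball x0 r} \<inter> W" using W(2) one_c r(1) by simp
  show ?thesis
    using openin_Int[OF openin_chart_preimage[OF c open_ball] W(1)] one Int_lower2 const by blast
qed

section \<open>Compactness forces commutativity\<close>

text \<open>By \<open>Ad_has_derivative\<close> the derivative of \<open>p \<mapsto> Ad p w\<close> vanishes throughout the domain of \<open>c\<close>, so the
  stabiliser of \<open>w\<close> contains a neighbourhood of the identity.\<close>

lemma Ad_fixes_of_bracket_eq_0:
  assumes T: "connected_space T" and bracket0: "\<And>v. bracket v w = 0" and a: "a \<in> carrier G"
  shows "Ad a w = w"
proof -
  define H where "H = {s \<in> carrier G. Ad s w = w}"
  have "subgroup H G"
  proof
    fix s assume s: "s \<in> H"
    then have "Ad (inv s) (Ad s w) = w"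
      using Ad_mult[of "inv s" s w] Ad_one by (simp add: H_def)
    then show "inv s \<in> H" using s by (simp add: H_def)
  qed (auto simp: H_def Ad_one Ad_mult)
  moreover have "\<exists>N. openin T N \<and> \<one> \<in> N \<and> N \<subseteq> fst c \<and> (\<forall>p\<in>N. Ad p w = Ad \<one> w)"
  proof (rule zero_derivative_imp_constant_near_one[OF openin_domain[OF c] one_c order_refl])
    fix p assume p: "p \<in> fst c"
    then have "linear (Ad p)" using linear_Ad dom_c by blast
    then show "((\<lambda>p. Ad p w) \<circ> chart_inv c has_derivative (\<lambda>v. 0)) (at (snd c p))"
      using Ad_has_derivative[of "snd c p" w] p c bracket0 linear_0[of "Ad p"] by (simp add: comp_def)
  qed
  then obtain N where "openin T N" "\<one> \<in> N" "N \<subseteq> H"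
    using dom_c unfolding H_def Ad_one by blast
  ultimately have "H = carrier G" using connected_subgroup_eq_carrier[OF T] by blast
  then show ?thesis using a by (auto simp: H_def)
qed

text \<open>The commutator map \<open>u\<close> satisfies \<open>u y = (a x a\<inverse>) u(x\<inverse> y) x\<inverse>\<close>, so its derivative at any \<open>x\<close>
  factors through its derivative at the identity, which is \<open>Ad\<^sub>a - id\<close>.\<close>

lemma commute_of_Ad_trivial:
  assumes T: "connected_space T" and Ad: "\<And>w. Ad a w = w"
    and a: "a \<in> carrier G" and b: "b \<in> carrier G"
  shows "a \<otimes> b = b \<otimes> a"
proof -
  define u where "u x = (a \<otimes> x \<otimes> inv a) \<otimes> inv x" for x
  define H where "H = {x \<in> carrier G. a \<otimes> x = x \<otimes> a}"
  have u: "diffable u" unfolding u_def by (intro diffable_mult[OF diffable_conj diffable_inv] a)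
  have u1: "u \<one> = \<one>" using a by (simp add: u_def)
  have Du1: "D c c u \<one> v = 0" for v
    unfolding u_def
    using product_rule[OF diffable_conj[OF a] diffable_inv c one_c c _ c _ c, of v] a one_c
    by (simp add: Ad_def[symmetric] Ad D_inv_one DF_one)
  define W where "W = {x \<in> fst c. u x \<in> fst c}"
  have W: "openin T W" "\<one> \<in> W" "W \<subseteq> fst c"
    using openin_preimage_domain[OF diffable_continuous[OF u] c c] one_c u1 by (auto simp: W_def)
  have "\<exists>N. openin T N \<and> \<one> \<in> N \<and> N \<subseteq> W \<and> (\<forall>p\<in>N. (snd c \<circ> u) p = (snd c \<circ> u) \<one>)"
  proof (rule zero_derivative_imp_constant_near_one[OF W])
    fix x assume "x \<in> W"
    then have x: "x \<in> fst c" "u x \<in> fst c" "x \<in> carrier G" using dom_c by (auto simp: W_def)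
    define \<theta> where "\<theta> y = (a \<otimes> x \<otimes> inv a) \<otimes> y \<otimes> inv x" for y
    have \<theta>: "diffable \<theta>" unfolding \<theta>_def
      using a x by (intro diffable_mult[OF diffable_left diffable_constant]) auto
    have \<theta>1: "\<theta> \<one> = u x" using a x by (simp add: \<theta>_def u_def)
    have L: "diffable (\<lambda>y. inv x \<otimes> y)" using x by (simp add: diffable_left)
    have uL: "diffable (\<lambda>y. u (inv x \<otimes> y))" by (rule diffable_compose[OF L u])
    have eq: "\<theta> (u (inv x \<otimes> y)) = u y" if "y \<in> carrier G" for y
    proof -
      have "inv x \<otimes> (x \<otimes> z) = z" "inv a \<otimes> (a \<otimes> z) = z" "a \<otimes> (inv a \<otimes> z) = z" "x \<otimes> (inv x \<otimes> z) = z"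
        if "z \<in> carrier G" for z using that a x by (simp_all add: m_assoc[symmetric])
      then show ?thesis using that a x by (simp add: \<theta>_def u_def m_assoc inv_mult_group)
    qed
    have "D c c u x v = 0" for v
    proof -
      have "D c c u x = D c c (\<lambda>y. \<theta> (u (inv x \<otimes> y))) x"
        by (rule D_cong[OF diffable_compose[OF uL \<theta>]])
           (use eq[of x] eq x c topspace_eq u1 \<theta>1 in auto)
      then have "D c c u x v = D c c (\<lambda>y. \<theta> (u (inv x \<otimes> y))) x v" by simp
      also have "D c c (\<lambda>y. \<theta> (u (inv x \<otimes> y))) x v = D c c \<theta> \<one> (D c c (\<lambda>y. u (inv x \<otimes> y)) x v)"
        using chain_rule[OF uL \<theta> c x(1) c _ c, of v] x one_c u1 \<theta>1 by simp
      also have "D c c (\<lambda>y. u (inv x \<otimes> y)) x v = D c c u \<one> (D c c (\<lambda>y. inv x \<otimes> y) x v)"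
        using chain_rule[OF L u c x(1) c _ c, of v] x one_c u1 by simp
      also have "\<dots> = 0" by (rule Du1)
      also have "D c c \<theta> \<one> 0 = 0"
        by (rule linear_0[OF linear_D[OF \<theta> c c one_c]]) (use x \<theta>1 in simp)
      finally show ?thesis .
    qed
    then have "D c c u x = (\<lambda>v. 0)" by blast
    then show "((snd c \<circ> u) \<circ> chart_inv c has_derivative (\<lambda>v. 0)) (at (snd c x))"
      using diffable_has_derivative[OF u c c x(1,2)] by simp
  qed
  then obtain N where N: "openin T N" "\<one> \<in> N" "N \<subseteq> W" "\<And>p. p \<in> N \<Longrightarrow> snd c (u p) = snd c \<one>"
    using u1 by auto
  have "N \<subseteq> H"
  proof
    fix x assume "x \<in> N"
    then have "u x = \<one>" "x \<in> carrier G"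
      using N(3,4) inj_onD[OF inj_chart[OF c]] one_c dom_c unfolding W_def by blast+
    then show "x \<in> H"
      using a unfolding u_def H_def by (smt (verit) inv_closed inv_equality inv_inv inv_solve_right m_closed mem_Collect_eq)
  qed
  moreover have "subgroup H G"
  proof
    fix x y assume "x \<in> H" "y \<in> H"
    then show "x \<otimes> y \<in> H" using a by (simp add: H_def) (metis m_assoc)
  next
    fix x assume "x \<in> H"
    then show "inv x \<in> H" using a unfolding H_def by (smt (verit) inv_closed inv_solve_left inv_solve_right m_assoc m_closed mem_Collect_eq)
  qed (use a in \<open>auto simp: H_def\<close>)
  ultimately have "H = carrier G" using connected_subgroup_eq_carrier[OF T] N(1,2) by blast
  then show ?thesis using b by (auto simp: H_def)
qed

text \<open>The orbit of \<open>w\<close> under \<open>Ad\<close> contains a longest vector \<open>Y\<close> by compactness. This \<open>Y\<close> is central, hence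
  fixed by \<open>Ad\<close>, and an orbit with a fixed point is a single point; so \<open>w = Y\<close>.\<close>

lemma Ad_trivial:
  assumes cyc: "cyclic_metric_lie_group G T A g" and T: "connected_space T" "compact_space T"
    and s: "s \<in> carrier G"
  shows "Ad s w = w"
proof -
  interpret ip: real_inner_form "metric_form g"
    using cyc by (intro real_inner_form_metric_form) (simp add: cyclic_metric_lie_group_def metric_lie_group_def)
  let ?\<phi> = "\<lambda>a. metric_form g (Ad a w) (Ad a w)"
  have cont: "continuous_map T euclidean ?\<phi>"
  proof -
    have "continuous_on UNIV (\<lambda>v. metric_form g v v)"
      by (intro bounded_bilinear.continuous_on[OF ip.bounded] continuous_on_id)
    then have "continuous_map euclidean euclidean (\<lambda>v. metric_form g v v)" by simp
    from continuous_map_compose[OF continuous_map_Ad this] show ?thesis by (simp add: comp_def)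
  qed
  have "compact (?\<phi> ` carrier G)"
    using image_compactin[OF _ cont, of "carrier G"] T(2) by (simp add: compact_space_def topspace_eq)
  then obtain a where a: "a \<in> carrier G" "\<And>b. b \<in> carrier G \<Longrightarrow> ?\<phi> b \<le> ?\<phi> a"
    using compact_attains_sup[of "?\<phi> ` carrier G"] one_topspace by blast
  define Y where "Y = Ad a w"
  have "bracket v Y = 0" for v
  proof (rule ip.bracket_eq_0_at_orbit_max[where br=bracket and Y=Y and v=v and B="snd c ` fst c" and p=x0 and A="\<lambda>y. Ad (chart_inv c y)"
        and lam=log_deriv and dlam="\<lambda>v u. DDF (0, v) (- u, u)"])
    fix y assume "y \<in> snd c ` fst c"
    then have y: "chart_inv c y \<in> carrier G" by (rule dom_c[OF chart_inv_in])
    then show "linear (Ad (chart_inv c y))" by (rule linear_Ad)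
    show "metric_form g (Ad (chart_inv c y) Y) (Ad (chart_inv c y) Y) \<le> metric_form g Y Y"
      using a(2)[of "chart_inv c y \<otimes> a"] Ad_mult[OF y a(1)] y a(1) by (simp add: Y_def)
  next
    show "x0 \<in> snd c ` fst c" using one_c by blast
    show "Ad (chart_inv c x0) u = u" for u using Ad_one c one_c by simp
  qed (fact bracket_bilinear bracket_skew cyclic_bracket[OF cyc] open_range[OF c] Ad_has_derivative
        linear_log_deriv log_deriv_one log_deriv_has_derivative)+
  then have fix_Y: "Ad b Y = Y" if "b \<in> carrier G" for b
    using Ad_fixes_of_bracket_eq_0[OF T(1)] that by blast
  have "Ad (inv a) Y = w" using Ad_mult[of "inv a" a w] a(1) Ad_one by (simp add: Y_def)
  then have "Y = w" using fix_Y[of "inv a"] a(1) by simp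
  then show ?thesis using fix_Y[OF s] by simp
qed

end

theorem theorem4p2:
  fixes G :: "('p, 'm) monoid_scheme"
    and T :: "'p topology"
    and A :: "('p, 'e::euclidean_space) chart set"
    and g :: "'p \<Rightarrow> ('p, 'e) tvec \<Rightarrow> ('p, 'e) tvec \<Rightarrow> real"
  assumes "cyclic_metric_lie_group G T A g"
    and "connected_space T"
    and "\<not> comm_group G"
  shows "\<not> compact_space T"
proof
  assume compact: "compact_space T"
  have lie: "lie_group G T A"
    using assms(1) by (simp add: cyclic_metric_lie_group_def metric_lie_group_def)
  then interpret lie_grp G T A
    by (simp add: lie_grp_def lie_grp_axioms_def manifold_def lie_group_def)
  obtain c where "c \<in> A" "\<one>\<^bsub>G\<^esub> \<in> fst c"
    using chart_at topspace_eq by blast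
  then interpret lie_grp_chart G T A c
    by unfold_locales
  have "comm_group G"
    using commute_of_Ad_trivial[OF assms(2)] Ad_trivial[OF assms(1,2) compact]
    by (intro group_comm_groupI) blast
  then show False using assms(3) by simp
qed

end
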